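(* Suppose the ellipticity assumption holds on $U$ (constants $c_0,M_1$) and the drift is bounded: there is a constant $M_2\ge 0$ with $|b(x)|\le M_2$ for all $x\in U$. Then there are constants $C_*>0$ and $\nu>0$ (independent of $u$) such that the following statements hold for every $u\in C^2(U)\cap C(\widetilde U)$. (i) Suppose $Lu\le 0$ in $U$ and $u\le 0$ on $\gamma$. Then there are only two possibilities. (a) One has $$u^+(x)\le \max_{y\in \mathcal S_{\theta_0}} u^+(y)\quad\text{for all }x\in \widetilde U,$$ $$\max_{x\in \mathcal S_\theta} u^+(x)\le C_*\Big(\max_{x\in \mathcal S_{\theta_0}} u^+(x)\Big)e^{-\nu(\theta-\theta_0)}\quad\text{for any }\theta\ge\theta_0.$$ (b) There are $C_1>0$ and $\bar\theta_1$, both depending on $u$, such that $$\max_{x\in \mathcal S_\theta} u^+(x)\ge C_1e^{\nu(\theta-\theta_0)}\quad \text{for all }\theta\ge \bar \theta_1.$$ (ii) Suppose $Lu=0$ in $U$ and $u=0$ on $\gamma$. Then there are only two possibilities. (a) One has $$|u(x)|\le \max_{y\in \mathcal S_{\theta_0}} |u(y)|\quad \text{for all }x\in \widetilde U,$$ $$\max_{x\in \mathcal S_\theta} |u(x)|\le C_*\Big(\max_{x\in \mathcal S_{\theta_0}} |u(x)|\Big)e^{-\nu(\theta-\theta_0)}\quad \text{for any }\theta\ge\theta_0.$$ (b) There are $C>0$ and $\bar\theta$, both depending on $u$, such that $$\max_{x\in \mathcal S_\theta} |u(x)| \ge Ce^{\nu(\theta-\theta_0)}\quad \text{for all }\theta\ge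 \bar \theta.$$
   Context: Domain. Let $X(r,\theta)=(r\cos\theta,r\sin\theta)$ for $r\ge0$, $\theta\in\mathbb R$. Fix $\theta_0\in\mathbb R$ and positive continuous functions $r_1,r_2$ on $[\theta_0,\infty)$ with $r_2(\theta+2\pi)<r_1(\theta)<r_2(\theta)$ for all $\theta\ge\theta_0$, and assume there is $r_*>0$ with $\lim_{\theta\to\infty}r_1(\theta)=\lim_{\theta\to\infty}r_2(\theta)=r_*$. Define $U=\{X(r,\theta):\theta>\theta_0,\ r_1(\theta)<r<r_2(\theta)\}$ (an open bounded subset of $\mathbb R^2$), $\widetilde U=\{X(r,\theta):\theta\ge\theta_0,\ r_1(\theta)\le r\le r_2(\theta)\}$, $\gamma=\{X(r_i(\theta),\theta):\theta\ge\theta_0,\ i=1,2\}$, and, for $\theta\ge\theta_0$, the cross-section $\mathcal S_\theta=\{X(r,\theta): r_1(\theta)\le r\le r_2(\theta)\}$. Functions in $C(\widetilde U)$ need not extend continuously to the limiting circle $|x|=r_*$. Operator. $A=(a_{ij})$ is a function from $U$ to the real symmetric $2\times2$ matrices, $b:U\to\mathbb R^2$, and $Lu=-\sum_{i,j=1}^2 a_{ij}\frac{\partial^2u}{\partial x_i\partial x_j}+b\cdot\nabla u$ for $u\in C^2(U)$. Ellipticity assumption on $U$: there are constants $c_0>0$, $M_1>0$ such that $\xi^{\rm T}A(x)\xi\ge c_0|\xi|^2$ and $\mathrm{Tr}(A(x))\le M_1$ for all $x\in U$, $\xi\in\mathbb R^2$. Notation: $u^+=\max\{0,u\}$. "There are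 only two possibilities" means that at least one of (a), (b) holds. *)

theory Defs
  imports "HOL-Analysis.Analysis"
begin

definition polar_pt :: "real \<Rightarrow> real \<Rightarrow> real ^ 2" where
  "polar_pt r \<theta> = vector [r * cos \<theta>, r * sin \<theta>]"

definition spiral_open :: "real \<Rightarrow> (real \<Rightarrow> real) \<Rightarrow> (real \<Rightarrow> real) \<Rightarrow> (real ^ 2) set" where
  "spiral_open \<theta>0 r1 r2 = {polar_pt r \<theta> | r \<theta>. \<theta> > \<theta>0 \<and> r1 \<theta> < r \<and> r < r2 \<theta>}"

text \<open>This is not the topological closure of the open spiral region: points of the limiting
  circle are not included.\<close>

definition spiral_closed :: "real \<Rightarrow> (real \<Rightarrow> real) \<Rightarrow> (real \<Rightarrow> real) \<Rightarrow> (real ^ 2) set" where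
  "spiral_closed \<theta>0 r1 r2 = {polar_pt r \<theta> | r \<theta>. \<theta> \<ge> \<theta>0 \<and> r1 \<theta> \<le> r \<and> r \<le> r2 \<theta>}"

definition spiral_sides :: "real \<Rightarrow> (real \<Rightarrow> real) \<Rightarrow> (real \<Rightarrow> real) \<Rightarrow> (real ^ 2) set" where
  "spiral_sides \<theta>0 r1 r2 =
     {polar_pt (r1 \<theta>) \<theta> | \<theta>. \<theta> \<ge> \<theta>0} \<union> {polar_pt (r2 \<theta>) \<theta> | \<theta>. \<theta> \<ge> \<theta>0}"

definition cross_section :: "(real \<Rightarrow> real) \<Rightarrow> (real \<Rightarrow> real) \<Rightarrow> real \<Rightarrow> (real ^ 2) set" where
  "cross_section r1 r2 \<theta> = {polar_pt r \<theta> | r. r1 \<theta> \<le> r \<and> r \<le> r2 \<theta>}"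

text \<open>Maxima over cross-sections are written with \<open>SUP\<close>; the following lemma shows that for
  continuous functions the supremum is attained.\<close>

lemma cross_section_max:
  fixes f :: "real ^ 2 \<Rightarrow> real"
  assumes "r1 \<theta> \<le> r2 \<theta>" and "continuous_on (cross_section r1 r2 \<theta>) f"
  shows "\<exists>x \<in> cross_section r1 r2 \<theta>.
           f x = (SUP y \<in> cross_section r1 r2 \<theta>. f y) \<and> (\<forall>y \<in> cross_section r1 r2 \<theta>. f y \<le> f x)"
proof -
  have eq: "cross_section r1 r2 \<theta> = (\<lambda>r. r *\<^sub>R polar_pt 1 \<theta>) ` {r1 \<theta>..r2 \<theta>}"
    by (auto simp: cross_section_def polar_pt_def image_def vec_eq_iff forall_2)
  have "compact (cross_section r1 r2 \<theta>)"
    unfolding eq by (intro compact_continuous_image continuous_intros compact_Icc)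
  moreover have "cross_section r1 r2 \<theta> \<noteq> {}"
    using assms(1) by (auto simp: eq)
  ultimately obtain x where x: "x \<in> cross_section r1 r2 \<theta>"
      "\<forall>y \<in> cross_section r1 r2 \<theta>. f y \<le> f x"
    using continuous_attains_sup[OF _ _ assms(2)] by blast
  then have "(SUP y \<in> cross_section r1 r2 \<theta>. f y) = f x"
    by (intro cSup_eq_maximum) auto
  with x show ?thesis by auto
qed

definition partial_deriv :: "2 \<Rightarrow> (real ^ 2 \<Rightarrow> real) \<Rightarrow> real ^ 2 \<Rightarrow> real" where
  "partial_deriv i f x = frechet_derivative f (at x) (axis i 1)"

text \<open>Since \<open>frechet_derivative\<close> is unspecified where a function is not differentiable,
  differentiability is required explicitly. These notions are meant for open \<open>S\<close>.\<close>

definition C1_on :: "(real ^ 2) set \<Rightarrow> (real ^ 2 \<Rightarrow> real) \<Rightarrow> bool" where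
  "C1_on S f \<longleftrightarrow>
     (\<forall>x \<in> S. f differentiable at x) \<and> (\<forall>i. continuous_on S (partial_deriv i f))"

definition C2_on :: "(real ^ 2) set \<Rightarrow> (real ^ 2 \<Rightarrow> real) \<Rightarrow> bool" where
  "C2_on S f \<longleftrightarrow> C1_on S f \<and> (\<forall>i. C1_on S (partial_deriv i f))"

definition elliptic_op ::
  "(real ^ 2 \<Rightarrow> real ^ 2 ^ 2) \<Rightarrow> (real ^ 2 \<Rightarrow> real ^ 2) \<Rightarrow> (real ^ 2 \<Rightarrow> real) \<Rightarrow> real ^ 2 \<Rightarrow> real" where
  "elliptic_op A b u x =
     - (\<Sum>i\<in>UNIV. \<Sum>j\<in>UNIV. A x $ i $ j * partial_deriv i (partial_deriv j u) x)
     + b x \<bullet> (\<chi> i. partial_deriv i u x)"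

end

theory Submission
  imports Defs
begin

text \<open>
  Near the limit circle \<open>|x| = r\<^sub>*\<close> the spiral lies in an annulus as thin as one likes, and there the
  two products \<open>w = e\<^bsup>\<plusminus>\<theta>\<^esup> P(|x|\<^sup>2)\<close> with the cap \<open>P(\<rho>) = 2 - ((\<rho> - r\<^sub>*\<^sup>2)/d)\<^sup>2\<close> satisfy
  \<open>L w > 0\<close>: by ellipticity the second radial derivative of the cap contributes a term of order
  \<open>d\<^sup>-\<^sup>2\<close>, while the angular, mixed and drift terms are \<open>O(d\<^sup>-\<^sup>1)\<close> (lemma
  \<open>polar_op_cap_pos\<close>). The width \<open>d\<close> depends only on \<open>c\<^sub>0\<close>, \<open>M\<^sub>1\<close>, \<open>M\<^sub>2\<close>, \<open>r\<^sub>*\<close>. Since \<open>P\<close> lies between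
  \<open>1\<close> and \<open>2\<close> on the annulus, comparison of a subsolution with a combination of both products on the
  piece of the spiral between the angles \<open>T \<le> t\<close> gives, for the cross-sectional maxima \<open>m\<close>,
  \<open>m(\<theta>) \<le> 2 (m(T) e\<^bsup>T-\<theta>\<^esup> + m(t) e\<^bsup>\<theta>-t\<^esup>)\<close> (lemma \<open>two_sided_decay\<close>).

  This already contains the dichotomy, with \<open>\<nu> = 1\<close>. If \<open>m(t) \<ge> C e\<^sup>t\<close> does not hold eventually for
  any \<open>C > 0\<close>, then \<open>m(t) e\<^bsup>-t\<^esup>\<close> gets arbitrarily small along some \<open>t \<rightarrow> \<infinity>\<close>, the second
  term disappears, and \<open>m\<close> decays exponentially from the angle \<open>T\<close> on. The maximum principle on
  bounded pieces of the spiral, started at \<open>\<theta>\<^sub>0\<close>, then bounds \<open>m\<close> by \<open>m(\<theta>\<^sub>0)\<close>, and the remaining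
  range between \<open>\<theta>\<^sub>0\<close> and \<open>T\<close> costs only the factor \<open>e\<^bsup>T-\<theta>\<^sub>0\<^esup>\<close> in the constant (lemma
  \<open>decay_or_growth\<close>).

  The barriers involve the angle, which is multivalued in the plane. Comparison therefore takes place
  on the compact set of parameters \<open>(r, \<theta>)\<close>. At an interior maximum \<open>u\<close> is compared with the
  barrier along straight lines through the point, lifted to the parameters by continuity
  (lemmas \<open>polar_pt_lift\<close> and \<open>operator_at_touching_point\<close>). Parts (i) and (ii) are treated
  together by working with the multiples \<open>\<sigma> u\<close>, where \<open>\<sigma> = 1\<close> for the positive part and
  \<open>\<sigma> = \<plusminus>1\<close> for the absolute value.
\<close>

section \<open>Lines in polar coordinates\<close>

text \<open>The vector with components \<open>p\<close> and \<open>q\<close> in the orthonormal frame of the radial and the angular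
  direction at the angle \<open>\<theta>\<close>.\<close>

definition frame_vec :: "real \<Rightarrow> real \<Rightarrow> real \<Rightarrow> real ^ 2" where
  "frame_vec \<theta> p q = vector [p * cos \<theta> - q * sin \<theta>, p * sin \<theta> + q * cos \<theta>]"

text \<open>An explicit local inverse of the polar coordinate map around the ray of angle \<open>\<theta>\<close>; it follows the
  branch of the angle that passes through \<open>\<theta>\<close>.\<close>

lemma polar_pt_lift:
  assumes "x > 0"
  shows "polar_pt (sqrt (x\<^sup>2 + y\<^sup>2)) (\<theta> + arctan (y / x)) = frame_vec \<theta> x y"
proof -
  have s: "sqrt (x\<^sup>2 + y\<^sup>2) = x * sqrt (1 + (y / x)\<^sup>2)"
  proof -
    have "x\<^sup>2 + y\<^sup>2 = x\<^sup>2 * (1 + (y / x)\<^sup>2)"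
      using assms by (simp add: field_simps)
    then show ?thesis
      using assms by (simp add: real_sqrt_mult)
  qed
  have pos: "sqrt (1 + (y / x)\<^sup>2) > 0"
    by (simp add: add_pos_nonneg)
  have c: "sqrt (x\<^sup>2 + y\<^sup>2) * cos (arctan (y / x)) = x"
    unfolding s cos_arctan using pos by simp
  have d: "sqrt (x\<^sup>2 + y\<^sup>2) * sin (arctan (y / x)) = y"
    unfolding s sin_arctan using pos assms by simp
  have "sqrt (x\<^sup>2 + y\<^sup>2) * cos (\<theta> + arctan (y / x)) = x * cos \<theta> - y * sin \<theta>"
    by (subst c[symmetric], subst (2) d[symmetric]) (simp only: cos_add algebra_simps)
  moreover have "sqrt (x\<^sup>2 + y\<^sup>2) * sin (\<theta> + arctan (y / x)) = x * sin \<theta> + y * cos \<theta>"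
    by (subst c[symmetric], subst (2) d[symmetric]) (simp only: sin_add algebra_simps)
  ultimately show ?thesis
    by (simp add: polar_pt_def frame_vec_def)
qed

lemma frame_vec_line:
  "frame_vec \<theta> (r + \<tau> * p) (\<tau> * q) = polar_pt r \<theta> + \<tau> *\<^sub>R frame_vec \<theta> p q"
  by (simp add: polar_pt_def frame_vec_def vec_eq_iff forall_2 algebra_simps)

lemma has_real_derivative_arctan_line:
  assumes "r + \<tau> * p \<noteq> (0::real)"
  shows "((\<lambda>\<tau>. arctan (\<tau> * q / (r + \<tau> * p))) has_real_derivative
            q * r / ((r + \<tau> * p)\<^sup>2 + (\<tau> * q)\<^sup>2)) (at \<tau>)"
proof -
  have "(r + \<tau> * p)\<^sup>2 > 0" using assms by simp
  then have nz: "(r + \<tau> * p)\<^sup>2 + (\<tau> * q)\<^sup>2 \<noteq> 0"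
    by (smt (verit) zero_le_power2)
  show ?thesis
    apply (rule derivative_eq_intros refl assms)+
    using assms nz \<open>(r + \<tau> * p)\<^sup>2 > 0\<close>
    apply (simp add: divide_simps)
    apply (simp add: power2_eq_square algebra_simps)
    done
qed

section \<open>Touching from above at an interior point\<close>

text \<open>If \<open>d\<close> were positive,
  \<open>f'\<close> would be positive just to the right of \<open>a\<close>, and \<open>f\<close> would increase there.\<close>

lemma second_derivative_test_max:
  fixes f f' :: "real \<Rightarrow> real"
  assumes f: "\<forall>\<^sub>F \<tau> in nhds a. (f has_real_derivative f' \<tau>) (at \<tau>)"
    and f': "(f' has_real_derivative d) (at a)"
    and max: "\<forall>\<^sub>F \<tau> in nhds a. f \<tau> \<le> f a"
  shows "f' a = 0" and "d \<le> 0"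
proof -
  from eventually_conj[OF f max] obtain e where e: "e > 0"
    "\<And>\<tau>. dist \<tau> a < e \<Longrightarrow> (f has_real_derivative f' \<tau>) (at \<tau>) \<and> f \<tau> \<le> f a"
    unfolding eventually_nhds_metric by blast
  have "(f has_real_derivative f' a) (at a)" using e by simp
  then show z: "f' a = 0"
    by (rule DERIV_local_max[OF _ e(1)]) (use e(2) in \<open>auto simp: dist_real_def abs_minus_commute\<close>)
  show "d \<le> 0"
  proof (rule ccontr)
    assume "\<not> d \<le> 0"
    then obtain k where k: "k > 0" "\<And>h. 0 < h \<Longrightarrow> h < k \<Longrightarrow> f' a < f' (a + h)"
      using DERIV_pos_inc_right[OF f'] by force
    define h where "h = min e k / 2"
    have h: "0 < h" "h < e" "h < k" using e(1) k(1) by (auto simp: h_def)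
    have cont: "continuous_on {a..a + h} f"
      by (rule DERIV_atLeastAtMost_imp_continuous_on)
         (use e(2) h in \<open>force simp: dist_real_def\<close>)
    have "f a < f (a + h)"
    proof (rule DERIV_pos_imp_increasing_open[of a "a + h" f])
      show "a < a + h" using h by simp
    next
      fix x assume x: "a < x" "x < a + h"
      have "(f has_real_derivative f' x) (at x)"
        using x h e(2)[of x] by (auto simp: dist_real_def)
      moreover have "0 < f' x" using k(2)[of "x - a"] x h z by simp
      ultimately show "\<exists>y. (f has_real_derivative y) (at x) \<and> 0 < y" by blast
    next
      show "continuous_on {a..a + h} f" by (rule cont)
    qed
    moreover have "f (a + h) \<le> f a"
      using e(2)[of "a + h"] h by (simp add: dist_real_def)
    ultimately show False by simp
  qed
qed

lemma has_real_derivative_along_line: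
  fixes f :: "real ^ 2 \<Rightarrow> real"
  assumes "f differentiable at (x + \<tau> *\<^sub>R \<xi>)"
  shows "((\<lambda>\<tau>. f (x + \<tau> *\<^sub>R \<xi>)) has_real_derivative
           (\<Sum>i\<in>UNIV. \<xi> $ i * partial_deriv i f (x + \<tau> *\<^sub>R \<xi>))) (at \<tau>)"
proof -
  let ?D = "frechet_derivative f (at (x + \<tau> *\<^sub>R \<xi>))"
  have D: "(f has_derivative ?D) (at (x + \<tau> *\<^sub>R \<xi>))"
    using assms frechet_derivative_works by blast
  interpret D: linear ?D using D has_derivative_linear by blast
  have expand: "?D \<xi> = (\<Sum>i\<in>UNIV. \<xi> $ i * partial_deriv i f (x + \<tau> *\<^sub>R \<xi>))"
  proof -
    have "\<xi> = (\<Sum>i\<in>UNIV. \<xi> $ i *\<^sub>R axis i 1)"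
      by (simp add: vec_eq_iff axis_def if_distrib cong: if_cong)
    then have "?D \<xi> = ?D (\<Sum>i\<in>UNIV. \<xi> $ i *\<^sub>R axis i 1)" by simp
    also have "\<dots> = (\<Sum>i\<in>UNIV. \<xi> $ i * partial_deriv i f (x + \<tau> *\<^sub>R \<xi>))"
      by (simp only: D.sum D.scaleR partial_deriv_def real_scaleR_def)
    finally show ?thesis .
  qed
  have "((\<lambda>\<tau>. x + \<tau> *\<^sub>R \<xi>) has_derivative (\<lambda>h. h *\<^sub>R \<xi>)) (at \<tau>)"
    by (auto intro!: derivative_eq_intros)
  from has_derivative_compose[OF this D]
  have "((\<lambda>\<tau>. f (x + \<tau> *\<^sub>R \<xi>)) has_derivative (\<lambda>h. ?D (h *\<^sub>R \<xi>))) (at \<tau>)" .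
  moreover have "(\<lambda>h. ?D (h *\<^sub>R \<xi>)) = (*) (?D \<xi>)"
    by (simp add: fun_eq_iff D.scaleR)
  ultimately show ?thesis
    by (simp add: has_field_derivative_def expand)
qed

definition hess_form :: "(real ^ 2 \<Rightarrow> real) \<Rightarrow> real ^ 2 \<Rightarrow> real ^ 2 \<Rightarrow> real" where
  "hess_form u x \<xi> = (\<Sum>i\<in>UNIV. \<Sum>j\<in>UNIV. \<xi> $ i * \<xi> $ j * partial_deriv i (partial_deriv j u) x)"

lemma C2_second_derivative_along_line:
  assumes u: "C2_on U u" and x: "x \<in> U"
  shows "((\<lambda>\<tau>. \<Sum>j\<in>UNIV. \<xi> $ j * partial_deriv j u (x + \<tau> *\<^sub>R \<xi>)) has_real_derivative
           hess_form u x \<xi>) (at 0)"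
proof -
  have "((\<lambda>\<tau>. partial_deriv j u (x + \<tau> *\<^sub>R \<xi>)) has_real_derivative
          (\<Sum>i\<in>UNIV. \<xi> $ i * partial_deriv i (partial_deriv j u) x)) (at 0)" for j
    using has_real_derivative_along_line[of "partial_deriv j u" x 0 \<xi>] u x
    by (simp add: C2_on_def C1_on_def)
  then have "((\<lambda>\<tau>. \<Sum>j\<in>UNIV. \<xi> $ j * partial_deriv j u (x + \<tau> *\<^sub>R \<xi>)) has_real_derivative
      (\<Sum>j\<in>UNIV. \<xi> $ j * (\<Sum>i\<in>UNIV. \<xi> $ i * partial_deriv i (partial_deriv j u) x))) (at 0)"
    by (intro DERIV_sum DERIV_cmult) auto
  also have "(\<Sum>j\<in>UNIV. \<xi> $ j * (\<Sum>i\<in>UNIV. \<xi> $ i * partial_deriv i (partial_deriv j u) x))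
      = hess_form u x \<xi>"
    by (simp add: hess_form_def sum_2 algebra_simps)
  finally show ?thesis .
qed

text \<open>The value of \<open>L w\<close> at \<open>(r, \<theta>)\<close> for a product \<open>w = F(\<theta>) P(r\<^sup>2)\<close>, when the matrix has the entries
  \<open>\<alpha>\<close>, \<open>\<beta>\<close>, \<open>\<delta>\<close> (radial, mixed, angular) and the drift the components \<open>b\<^sub>r\<close>, \<open>b\<^sub>t\<close> in the rotated
  frame. The six arguments after \<open>r\<close> are the values of the two factors and of their first two
  derivatives. Taking \<open>r\<^sup>2\<close> as the radial variable keeps it polynomial along lines.\<close>

definition polar_op :: "real \<Rightarrow> real \<Rightarrow> real \<Rightarrow> real \<Rightarrow> real \<Rightarrow> real \<Rightarrow>
    real \<Rightarrow> real \<Rightarrow> real \<Rightarrow> real \<Rightarrow> real \<Rightarrow> real \<Rightarrow> real" where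
  "polar_op \<alpha> \<beta> \<delta> b\<^sub>r b\<^sub>t r F F' F'' P P' P'' =
     - (4 * r\<^sup>2 * \<alpha> * F * P'' + 2 * (\<alpha> + \<delta>) * F * P' + \<beta> * F' * (4 * P' - 2 * P / r\<^sup>2)
        + \<delta> * F'' * P / r\<^sup>2)
     + 2 * r * b\<^sub>r * F * P' + b\<^sub>t * F' * P / r"

text \<open>Along a line the lifted angle has derivative \<open>q r / \<rho>\<close>, where \<open>\<rho>\<close> is the square of the distance
  to the origin, so two applications of the product rule give the gradient and the Hessian form of
  \<open>F(\<theta>) P(r\<^sup>2)\<close> in the direction \<open>(p, q)\<close>.\<close>

lemma barrier_derivatives_along_line:
  fixes F F' P P' :: "real \<Rightarrow> real"
    and r \<theta> p q :: real
  assumes r: "r > 0"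
    and F: "\<And>x. (F has_real_derivative F' x) (at x)" and F': "(F' has_real_derivative F'') (at \<theta>)"
    and P: "\<And>x. (P has_real_derivative P' x) (at x)" and P': "(P' has_real_derivative P'') (at (r\<^sup>2))"
  defines "g \<equiv> \<lambda>\<tau>. F (\<theta> + arctan (\<tau> * q / (r + \<tau> * p))) * P ((r + \<tau> * p)\<^sup>2 + (\<tau> * q)\<^sup>2)"
  shows "\<exists>g'. (\<forall>\<^sub>F \<tau> in nhds 0. (g has_real_derivative g' \<tau>) (at \<tau>)) \<and>
     g' 0 = F' \<theta> * P (r\<^sup>2) * q / r + 2 * r * p * F \<theta> * P' (r\<^sup>2) \<and>
     (g' has_real_derivative
        (4 * r\<^sup>2 * p\<^sup>2 * F \<theta> * P'' + 2 * (p\<^sup>2 + q\<^sup>2) * F \<theta> * P' (r\<^sup>2)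
          + p * q * F' \<theta> * (4 * P' (r\<^sup>2) - 2 * P (r\<^sup>2) / r\<^sup>2) + q\<^sup>2 * F'' * P (r\<^sup>2) / r\<^sup>2)) (at 0)"
proof -
  define a where "a = (\<lambda>\<tau>. \<theta> + arctan (\<tau> * q / (r + \<tau> * p)))"
  define \<rho> where "\<rho> = (\<lambda>\<tau>. (r + \<tau> * p)\<^sup>2 + (\<tau> * q)\<^sup>2)"
  define \<rho>' where "\<rho>' = (\<lambda>\<tau>. 2 * (r + \<tau> * p) * p + 2 * \<tau> * q\<^sup>2)"
  define g' where "g' = (\<lambda>\<tau>. F' (a \<tau>) * (q * r / \<rho> \<tau>) * P (\<rho> \<tau>) + F (a \<tau>) * (P' (\<rho> \<tau>) * \<rho>' \<tau>))"
  have g: "g = (\<lambda>\<tau>. F (a \<tau>) * P (\<rho> \<tau>))" by (simp add: g_def a_def \<rho>_def)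
  have d\<rho>: "(\<rho> has_real_derivative \<rho>' \<tau>) (at \<tau>)" for \<tau>
    unfolding \<rho>_def \<rho>'_def
    by (auto intro!: derivative_eq_intros simp: power2_eq_square algebra_simps)
  have d\<rho>': "(\<rho>' has_real_derivative 2 * (p\<^sup>2 + q\<^sup>2)) (at \<tau>)" for \<tau>
    unfolding \<rho>'_def by (auto intro!: derivative_eq_intros simp: power2_eq_square algebra_simps)
  have da: "(a has_real_derivative q * r / \<rho> \<tau>) (at \<tau>)" if "r + \<tau> * p \<noteq> 0" for \<tau>
    unfolding a_def \<rho>_def
    by (rule derivative_eq_intros refl has_real_derivative_arctan_line that)+ simp
  have "((\<lambda>\<tau>. r + \<tau> * p) \<longlongrightarrow> r + 0 * p) (nhds 0)"
    by (intro tendsto_add tendsto_mult tendsto_const) (simp add: filterlim_def)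
  then have ev: "\<forall>\<^sub>F \<tau> in nhds 0. r + \<tau> * p > 0"
    using r by (intro order_tendstoD(1)[where y = "r + 0 * p"]) auto
  have e1: "\<forall>\<^sub>F \<tau> in nhds 0. (g has_real_derivative g' \<tau>) (at \<tau>)"
    using ev
  proof eventually_elim
    case (elim \<tau>)
    have "((\<lambda>\<tau>. F (a \<tau>)) has_real_derivative F' (a \<tau>) * (q * r / \<rho> \<tau>)) (at \<tau>)"
      by (rule DERIV_chain2[OF F da]) (use elim in simp)
    moreover have "((\<lambda>\<tau>. P (\<rho> \<tau>)) has_real_derivative P' (\<rho> \<tau>) * \<rho>' \<tau>) (at \<tau>)"
      by (rule DERIV_chain2[OF P d\<rho>])
    ultimately show ?case unfolding g g'_def
      using DERIV_mult by (fastforce simp: algebra_simps)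
  qed
  have z: "a 0 = \<theta>" "\<rho> 0 = r\<^sup>2" "\<rho>' 0 = 2 * r * p" by (auto simp: a_def \<rho>_def \<rho>'_def)
  have e2: "g' 0 = F' \<theta> * P (r\<^sup>2) * q / r + 2 * r * p * F \<theta> * P' (r\<^sup>2)"
    using r by (simp add: g'_def z power2_eq_square)
  have dF': "((\<lambda>\<tau>. F' (a \<tau>)) has_real_derivative F'' * (q * r / \<rho> 0)) (at 0)"
    by (rule DERIV_chain2[of F']) (use F' da[of 0] r z in auto)
  have dP': "((\<lambda>\<tau>. P' (\<rho> \<tau>)) has_real_derivative P'' * \<rho>' 0) (at 0)"
    by (rule DERIV_chain2[of P']) (use P' d\<rho>[of 0] r z in auto)
  have dF: "((\<lambda>\<tau>. F (a \<tau>)) has_real_derivative F' (a 0) * (q * r / \<rho> 0)) (at 0)"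
    by (rule DERIV_chain2[OF F]) (use da[of 0] r in auto)
  have dP: "((\<lambda>\<tau>. P (\<rho> \<tau>)) has_real_derivative P' (\<rho> 0) * \<rho>' 0) (at 0)"
    by (rule DERIV_chain2[OF P d\<rho>])
  have e3: "(g' has_real_derivative
        (4 * r\<^sup>2 * p\<^sup>2 * F \<theta> * P'' + 2 * (p\<^sup>2 + q\<^sup>2) * F \<theta> * P' (r\<^sup>2)
          + p * q * F' \<theta> * (4 * P' (r\<^sup>2) - 2 * P (r\<^sup>2) / r\<^sup>2) + q\<^sup>2 * F'' * P (r\<^sup>2) / r\<^sup>2)) (at 0)"
  proof -
    have nz: "\<rho> 0 \<noteq> 0" using r z by simp
    have q: "((\<lambda>\<tau>. q * r / \<rho> \<tau>) has_real_derivative - (2 * p * q / r\<^sup>2)) (at 0)"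
      by (rule derivative_eq_intros refl d\<rho> nz)+ (use r in \<open>simp add: z field_simps power2_eq_square\<close>)
    note DERIV_add[OF DERIV_mult[OF DERIV_mult[OF dF' q] dP] DERIV_mult[OF dF DERIV_mult[OF dP' d\<rho>']]]
    then show ?thesis
      unfolding g'_def z by (rule DERIV_cong) (use r in \<open>simp add: field_simps power2_eq_square\<close>)
  qed
  from e1 e2 e3 show ?thesis by blast
qed

text \<open>The entries of a symmetric matrix in the rotated frame.\<close>

definition polar_rr :: "real ^ 2 ^ 2 \<Rightarrow> real \<Rightarrow> real" where
  "polar_rr M \<theta> = M $ 1 $ 1 * (cos \<theta>)\<^sup>2 + 2 * M $ 1 $ 2 * cos \<theta> * sin \<theta> + M $ 2 $ 2 * (sin \<theta>)\<^sup>2"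

definition polar_rt :: "real ^ 2 ^ 2 \<Rightarrow> real \<Rightarrow> real" where
  "polar_rt M \<theta> = (M $ 2 $ 2 - M $ 1 $ 1) * cos \<theta> * sin \<theta> + M $ 1 $ 2 * ((cos \<theta>)\<^sup>2 - (sin \<theta>)\<^sup>2)"

definition polar_tt :: "real ^ 2 ^ 2 \<Rightarrow> real \<Rightarrow> real" where
  "polar_tt M \<theta> = M $ 1 $ 1 * (sin \<theta>)\<^sup>2 - 2 * M $ 1 $ 2 * cos \<theta> * sin \<theta> + M $ 2 $ 2 * (cos \<theta>)\<^sup>2"

lemma polar_form:
  assumes "transpose M = (M :: real ^ 2 ^ 2)"
  shows "frame_vec \<theta> p q \<bullet> (M *v frame_vec \<theta> p q)
     = polar_rr M \<theta> * p\<^sup>2 + 2 * polar_rt M \<theta> * p * q + polar_tt M \<theta> * q\<^sup>2"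
proof -
  have "M $ 2 $ 1 = M $ 1 $ 2"
    using arg_cong[OF assms, of "\<lambda>N. N $ 1 $ 2"] by (simp add: transpose_def)
  then show ?thesis
    by (simp add: frame_vec_def inner_vec_def matrix_vector_mult_def sum_2 polar_rr_def
        polar_rt_def polar_tt_def power2_eq_square algebra_simps)
qed

lemma norm_frame_vec: "(norm (frame_vec \<theta> p q))\<^sup>2 = p\<^sup>2 + q\<^sup>2"
proof -
  have "(p * cos \<theta> - q * sin \<theta>)\<^sup>2 + (p * sin \<theta> + q * cos \<theta>)\<^sup>2
      = (p\<^sup>2 + q\<^sup>2) * ((sin \<theta>)\<^sup>2 + (cos \<theta>)\<^sup>2)"
    by (simp only: power2_eq_square algebra_simps)
  then show ?thesis
    by (simp add: frame_vec_def norm_vec_def L2_set_def sum_2)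
qed

lemma polar_trace: "polar_rr M \<theta> + polar_tt M \<theta> = trace M"
proof -
  have "polar_rr M \<theta> + polar_tt M \<theta> = (M $ 1 $ 1 + M $ 2 $ 2) * ((sin \<theta>)\<^sup>2 + (cos \<theta>)\<^sup>2)"
    unfolding polar_rr_def polar_tt_def by (simp only: algebra_simps)
  then show ?thesis by (simp add: trace_def sum_2)
qed

text \<open>Ellipticity tested with vectors of the rotated frame: \<open>(1, 0)\<close> and \<open>(0, 1)\<close> for the diagonal,
  \<open>(-\<beta>, \<alpha>)\<close> for the determinant, \<open>(1, 1)\<close> and \<open>(1, -1)\<close> for the mixed entry.\<close>

lemma polar_elliptic:
  assumes sym: "transpose M = (M :: real ^ 2 ^ 2)" and c: "c > 0"
    and ell: "\<And>\<xi>. \<xi> \<bullet> (M *v \<xi>) \<ge> c * (norm \<xi>)\<^sup>2"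
  shows "polar_rr M \<theta> \<ge> c" "polar_tt M \<theta> \<ge> c" "(polar_rt M \<theta>)\<^sup>2 \<le> polar_rr M \<theta> * polar_tt M \<theta>"
    "2 * \<bar>polar_rt M \<theta>\<bar> \<le> trace M"
proof -
  have f: "polar_rr M \<theta> * p\<^sup>2 + 2 * polar_rt M \<theta> * p * q + polar_tt M \<theta> * q\<^sup>2 \<ge> c * (p\<^sup>2 + q\<^sup>2)" for p q
    using ell[of "frame_vec \<theta> p q"] by (simp add: polar_form[OF sym] norm_frame_vec)
  show 1: "polar_rr M \<theta> \<ge> c" using f[of 1 0] by simp
  show "polar_tt M \<theta> \<ge> c" using f[of 0 1] by simp
  have "0 \<le> polar_rr M \<theta> + 2 * polar_rt M \<theta> + polar_tt M \<theta>"
    using f[of 1 1] c by (simp add: algebra_simps)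
  moreover have "0 \<le> polar_rr M \<theta> - 2 * polar_rt M \<theta> + polar_tt M \<theta>"
    using f[of 1 "-1"] c by (simp add: algebra_simps)
  ultimately show "2 * \<bar>polar_rt M \<theta>\<bar> \<le> trace M"
    unfolding polar_trace[of M \<theta>, symmetric] by linarith
  have "0 \<le> c * ((- polar_rt M \<theta>)\<^sup>2 + (polar_rr M \<theta>)\<^sup>2)" using c by simp
  also note f[of "- polar_rt M \<theta>" "polar_rr M \<theta>"]
  also have "polar_rr M \<theta> * (- polar_rt M \<theta>)\<^sup>2 + 2 * polar_rt M \<theta> * (- polar_rt M \<theta>) * polar_rr M \<theta>
        + polar_tt M \<theta> * (polar_rr M \<theta>)\<^sup>2
      = polar_rr M \<theta> * (polar_rr M \<theta> * polar_tt M \<theta> - (polar_rt M \<theta>)\<^sup>2)"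
    by (simp only: power2_eq_square) (simp only: algebra_simps)
  finally have "0 \<le> polar_rr M \<theta> * (polar_rr M \<theta> * polar_tt M \<theta> - (polar_rt M \<theta>)\<^sup>2)" .
  moreover have "polar_rr M \<theta> > 0" using 1 c by simp
  ultimately have "0 \<le> polar_rr M \<theta> * polar_tt M \<theta> - (polar_rt M \<theta>)\<^sup>2"
    by (metis zero_le_mult_iff not_less)
  then show "(polar_rt M \<theta>)\<^sup>2 \<le> polar_rr M \<theta> * polar_tt M \<theta>" by simp
qed

text \<open>Completing the square, a symmetric matrix with entries \<open>\<alpha>\<close>, \<open>\<beta>\<close>, \<open>\<delta>\<close> equals
  \<open>\<alpha>\<^sup>-\<^sup>1 \<xi>\<xi>\<^sup>T + (\<delta> - \<beta>\<^sup>2/\<alpha>) \<eta>\<eta>\<^sup>T\<close> with \<open>\<xi> = (\<alpha>, \<beta>)\<close> and \<open>\<eta> = (0, 1)\<close>. For an elliptic matrix both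
  weights are nonnegative, so the second-order part of \<open>L\<close> is controlled by second derivatives along
  two lines.\<close>

lemma hess_form_polar:
  assumes sym: "transpose M = (M :: real ^ 2 ^ 2)" and nz: "polar_rr M \<theta> \<noteq> 0"
  defines "\<alpha> \<equiv> polar_rr M \<theta>" and "\<beta> \<equiv> polar_rt M \<theta>" and "\<delta> \<equiv> polar_tt M \<theta>"
  shows "(\<Sum>i\<in>UNIV. \<Sum>j\<in>UNIV. M $ i $ j * partial_deriv i (partial_deriv j u) x)
     = hess_form u x (frame_vec \<theta> \<alpha> \<beta>) / \<alpha> + (\<delta> - \<beta>\<^sup>2 / \<alpha>) * hess_form u x (frame_vec \<theta> 0 1)"
proof -
  define k s where "k = cos \<theta>" and "s = sin \<theta>"
  have ks: "s\<^sup>2 + k\<^sup>2 = 1" by (simp add: k_def s_def)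
  have m21: "M $ 2 $ 1 = M $ 1 $ 2"
    using arg_cong[OF sym, of "\<lambda>N. N $ 1 $ 2"] by (simp add: transpose_def)
  define m11 m12 m22 where "m11 = M $ 1 $ 1" and "m12 = M $ 1 $ 2" and "m22 = M $ 2 $ 2"
  have ab: "\<alpha> = m11 * k\<^sup>2 + 2 * m12 * k * s + m22 * s\<^sup>2"
     "\<beta> = (m22 - m11) * k * s + m12 * (k\<^sup>2 - s\<^sup>2)"
     "\<delta> = m11 * s\<^sup>2 - 2 * m12 * k * s + m22 * k\<^sup>2"
    by (simp_all add: \<alpha>_def \<beta>_def \<delta>_def polar_rr_def polar_rt_def polar_tt_def k_def s_def
        m11_def m12_def m22_def)
  have "m11 * (s\<^sup>2 + k\<^sup>2)\<^sup>2 = \<alpha> * k\<^sup>2 - 2 * \<beta> * k * s + \<delta> * s\<^sup>2"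
    unfolding ab by (simp add: power2_eq_square algebra_simps)
  then have i11: "m11 = \<alpha> * k\<^sup>2 - 2 * \<beta> * k * s + \<delta> * s\<^sup>2"
    by (simp add: ks)
  have "m12 * (s\<^sup>2 + k\<^sup>2)\<^sup>2 = (\<alpha> - \<delta>) * k * s + \<beta> * (k\<^sup>2 - s\<^sup>2)"
    unfolding ab by (simp add: power2_eq_square algebra_simps)
  then have i12: "m12 = (\<alpha> - \<delta>) * k * s + \<beta> * (k\<^sup>2 - s\<^sup>2)"
    by (simp add: ks)
  have "m22 * (s\<^sup>2 + k\<^sup>2)\<^sup>2 = \<alpha> * s\<^sup>2 + 2 * \<beta> * k * s + \<delta> * k\<^sup>2"
    unfolding ab by (simp add: power2_eq_square algebra_simps)
  then have i22: "m22 = \<alpha> * s\<^sup>2 + 2 * \<beta> * k * s + \<delta> * k\<^sup>2"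
    by (simp add: ks)
  have nz': "\<alpha> \<noteq> 0" using nz by (simp add: \<alpha>_def)
  have f: "frame_vec \<theta> \<alpha> \<beta> $ 1 = \<alpha> * k - \<beta> * s" "frame_vec \<theta> \<alpha> \<beta> $ 2 = \<alpha> * s + \<beta> * k"
    "frame_vec \<theta> 0 1 $ 1 = - s" "frame_vec \<theta> 0 1 $ 2 = k"
    by (simp_all add: frame_vec_def k_def s_def)
  have e1: "(\<alpha> * k - \<beta> * s) * (\<alpha> * k - \<beta> * s) / \<alpha> + (\<delta> - \<beta>\<^sup>2 / \<alpha>) * (s * s) = m11"
    unfolding i11 using nz' by (simp add: field_simps power2_eq_square)
  have e2: "(\<alpha> * k - \<beta> * s) * (\<alpha> * s + \<beta> * k) / \<alpha> - (\<delta> - \<beta>\<^sup>2 / \<alpha>) * (s * k) = m12"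
    unfolding i12 using nz' by (simp add: field_simps power2_eq_square)
  have e3: "(\<alpha> * s + \<beta> * k) * (\<alpha> * s + \<beta> * k) / \<alpha> + (\<delta> - \<beta>\<^sup>2 / \<alpha>) * (k * k) = m22"
    unfolding i22 using nz' by (simp add: field_simps power2_eq_square)
  define H where "H = (\<lambda>i j. partial_deriv i (partial_deriv j u) x)"
  have hf: "hess_form u x \<xi> = \<xi> $ 1 * \<xi> $ 1 * H 1 1 + \<xi> $ 1 * \<xi> $ 2 * (H 1 2 + H 2 1)
      + \<xi> $ 2 * \<xi> $ 2 * H 2 2" for \<xi>
    by (simp add: hess_form_def H_def sum_2 algebra_simps)
  have "hess_form u x (frame_vec \<theta> \<alpha> \<beta>) / \<alpha> + (\<delta> - \<beta>\<^sup>2 / \<alpha>) * hess_form u x (frame_vec \<theta> 0 1)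
    = ((\<alpha> * k - \<beta> * s) * (\<alpha> * k - \<beta> * s) / \<alpha> + (\<delta> - \<beta>\<^sup>2 / \<alpha>) * (s * s)) * H 1 1
    + ((\<alpha> * k - \<beta> * s) * (\<alpha> * s + \<beta> * k) / \<alpha> - (\<delta> - \<beta>\<^sup>2 / \<alpha>) * (s * k)) * (H 1 2 + H 2 1)
    + ((\<alpha> * s + \<beta> * k) * (\<alpha> * s + \<beta> * k) / \<alpha> + (\<delta> - \<beta>\<^sup>2 / \<alpha>) * (k * k)) * H 2 2"
    unfolding hf f by (simp add: divide_inverse algebra_simps)
  also have "\<dots> = (\<Sum>i\<in>UNIV. \<Sum>j\<in>UNIV. M $ i $ j * H i j)"
    unfolding e1 e2 e3 sum_2 m21 m11_def m12_def m22_def by (simp add: algebra_simps)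
  finally show ?thesis by (simp add: H_def)
qed


lemma frame_vec_inner: "x = frame_vec \<theta> (x \<bullet> frame_vec \<theta> 1 0) (x \<bullet> frame_vec \<theta> 0 1)"
proof -
  define k s where "k = cos \<theta>" and "s = sin \<theta>"
  have ks: "s\<^sup>2 + k\<^sup>2 = 1" by (simp add: k_def s_def)
  have "x $ 1 * (s\<^sup>2 + k\<^sup>2) = (x $ 1 * k + x $ 2 * s) * k - (x $ 2 * k - x $ 1 * s) * s"
    "x $ 2 * (s\<^sup>2 + k\<^sup>2) = (x $ 1 * k + x $ 2 * s) * s + (x $ 2 * k - x $ 1 * s) * k"
    by (simp_all add: power2_eq_square algebra_simps)
  then show ?thesis
    unfolding ks by (simp add: vec_eq_iff forall_2 frame_vec_def inner_vec_def sum_2 k_def s_def)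
qed

text \<open>The classical comparison of second-order data at a maximum of \<open>\<sigma> u - w\<close>: gradients agree and second
  derivatives are ordered along every line, hence \<open>L w \<le> \<sigma> L u\<close> there. The hypothesis is phrased
  through the lift along lines, because \<open>w\<close> is a function of \<open>(r, \<theta>)\<close> rather than of the point.\<close>

lemma operator_at_touching_point:
  fixes F F' F'' P P' P'' :: "real \<Rightarrow> real" and r \<theta> \<sigma> :: real
  defines "x \<equiv> polar_pt r \<theta>"
  assumes r: "r > 0" and u: "C2_on U u" and x: "x \<in> U"
    and F: "\<And>y. (F has_real_derivative F' y) (at y)" and F': "\<And>y. (F' has_real_derivative F'' y) (at y)"
    and P: "\<And>y. (P has_real_derivative P' y) (at y)" and P': "\<And>y. (P' has_real_derivative P'' y) (at y)"
    and touch: "\<And>p q. \<forall>\<^sub>F \<tau> in nhds 0. x + \<tau> *\<^sub>R frame_vec \<theta> p q \<in> U \<and>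
       \<sigma> * u (x + \<tau> *\<^sub>R frame_vec \<theta> p q)
         - F (\<theta> + arctan (\<tau> * q / (r + \<tau> * p))) * P ((r + \<tau> * p)\<^sup>2 + (\<tau> * q)\<^sup>2)
       \<le> \<sigma> * u x - F \<theta> * P (r\<^sup>2)"
    and sym: "transpose (A x) = A x" and c: "c > 0"
    and ell: "\<And>\<xi>. \<xi> \<bullet> (A x *v \<xi>) \<ge> c * (norm \<xi>)\<^sup>2"
  shows "polar_op (polar_rr (A x) \<theta>) (polar_rt (A x) \<theta>) (polar_tt (A x) \<theta>)
       (b x \<bullet> frame_vec \<theta> 1 0) (b x \<bullet> frame_vec \<theta> 0 1) r
       (F \<theta>) (F' \<theta>) (F'' \<theta>) (P (r\<^sup>2)) (P' (r\<^sup>2)) (P'' (r\<^sup>2))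
     \<le> \<sigma> * elliptic_op A b u x"
proof -
  define G where "G = (\<lambda>p q. 4 * r\<^sup>2 * p\<^sup>2 * F \<theta> * P'' (r\<^sup>2) + 2 * (p\<^sup>2 + q\<^sup>2) * F \<theta> * P' (r\<^sup>2)
      + p * q * F' \<theta> * (4 * P' (r\<^sup>2) - 2 * P (r\<^sup>2) / r\<^sup>2) + q\<^sup>2 * F'' \<theta> * P (r\<^sup>2) / r\<^sup>2)"
  have dir: "\<sigma> * (\<Sum>j\<in>UNIV. frame_vec \<theta> p q $ j * partial_deriv j u x)
        = F' \<theta> * P (r\<^sup>2) * q / r + 2 * r * p * F \<theta> * P' (r\<^sup>2) \<and>
      \<sigma> * hess_form u x (frame_vec \<theta> p q) \<le> G p q" for p q
  proof -
    define \<xi> where "\<xi> = frame_vec \<theta> p q"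
    define g where "g = (\<lambda>\<tau>. F (\<theta> + arctan (\<tau> * q / (r + \<tau> * p))) * P ((r + \<tau> * p)\<^sup>2 + (\<tau> * q)\<^sup>2))"
    obtain g' where g': "\<forall>\<^sub>F \<tau> in nhds 0. (g has_real_derivative g' \<tau>) (at \<tau>)"
       "g' 0 = F' \<theta> * P (r\<^sup>2) * q / r + 2 * r * p * F \<theta> * P' (r\<^sup>2)"
       "(g' has_real_derivative G p q) (at 0)"
      using barrier_derivatives_along_line[where F = F and P = P and \<theta> = \<theta> and p = p and q = q, OF r F F' P P']
      unfolding g_def G_def by blast
    define f where "f = (\<lambda>\<tau>. \<sigma> * u (x + \<tau> *\<^sub>R \<xi>) - g \<tau>)"
    define f' where "f' = (\<lambda>\<tau>. \<sigma> * (\<Sum>j\<in>UNIV. \<xi> $ j * partial_deriv j u (x + \<tau> *\<^sub>R \<xi>)) - g' \<tau>)"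
    have 1: "\<forall>\<^sub>F \<tau> in nhds 0. (f has_real_derivative f' \<tau>) (at \<tau>)"
      using g'(1) touch[of p q]
    proof eventually_elim
      case (elim \<tau>)
      have "u differentiable at (x + \<tau> *\<^sub>R \<xi>)"
        using u elim unfolding C2_on_def C1_on_def \<xi>_def by blast
      then show ?case unfolding f_def f'_def
        using elim(1) by (intro DERIV_diff DERIV_cmult has_real_derivative_along_line)
    qed
    have 2: "(f' has_real_derivative \<sigma> * hess_form u x \<xi> - G p q) (at 0)"
      unfolding f'_def by (intro DERIV_diff DERIV_cmult C2_second_derivative_along_line[OF u x] g')
    have 3: "\<forall>\<^sub>F \<tau> in nhds 0. f \<tau> \<le> f 0"
      using touch[of p q] by eventually_elim (simp add: f_def g_def \<xi>_def)
    from second_derivative_test_max[OF 1 2 3] show ?thesis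
      by (simp add: f'_def g'(2) \<xi>_def)
  qed
  define \<alpha> \<beta> \<delta> where "\<alpha> = polar_rr (A x) \<theta>" and "\<beta> = polar_rt (A x) \<theta>" and "\<delta> = polar_tt (A x) \<theta>"
  have a: "\<alpha> > 0" and ab: "\<beta>\<^sup>2 \<le> \<alpha> * \<delta>"
    using polar_elliptic[OF sym c ell, of \<theta>] c by (auto simp: \<alpha>_def \<beta>_def \<delta>_def)
  have d: "\<delta> - \<beta>\<^sup>2 / \<alpha> \<ge> 0" using a ab by (simp add: field_simps)
  have H: "\<sigma> * (\<Sum>i\<in>UNIV. \<Sum>j\<in>UNIV. A x $ i $ j * partial_deriv i (partial_deriv j u) x)
     = (\<sigma> * hess_form u x (frame_vec \<theta> \<alpha> \<beta>)) / \<alpha>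
       + (\<delta> - \<beta>\<^sup>2 / \<alpha>) * (\<sigma> * hess_form u x (frame_vec \<theta> 0 1))"
    unfolding \<alpha>_def \<beta>_def \<delta>_def hess_form_polar[OF sym less_imp_neq[OF a[unfolded \<alpha>_def], symmetric]]
    by (simp add: distrib_left mult_ac)
  also have "\<dots> \<le> G \<alpha> \<beta> / \<alpha> + (\<delta> - \<beta>\<^sup>2 / \<alpha>) * G 0 1"
    using dir a d by (intro add_mono divide_right_mono mult_left_mono) auto
  also have "\<dots> = 4 * r\<^sup>2 * \<alpha> * F \<theta> * P'' (r\<^sup>2) + 2 * (\<alpha> + \<delta>) * F \<theta> * P' (r\<^sup>2)
      + \<beta> * F' \<theta> * (4 * P' (r\<^sup>2) - 2 * P (r\<^sup>2) / r\<^sup>2) + \<delta> * F'' \<theta> * P (r\<^sup>2) / r\<^sup>2"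
  proof -
    define X where "X = 4 * P' (r\<^sup>2) - 2 * P (r\<^sup>2) / r\<^sup>2"
    define Y where "Y = F'' \<theta> * P (r\<^sup>2) / r\<^sup>2"
    define Z where "Z = F \<theta> * P' (r\<^sup>2)"
    have G: "G p q = 4 * r\<^sup>2 * p\<^sup>2 * F \<theta> * P'' (r\<^sup>2) + 2 * (p\<^sup>2 + q\<^sup>2) * Z + p * q * F' \<theta> * X + q\<^sup>2 * Y" for p q
      by (simp add: G_def X_def Y_def Z_def)
    have "G \<alpha> \<beta> / \<alpha> + (\<delta> - \<beta>\<^sup>2 / \<alpha>) * G 0 1
      = 4 * r\<^sup>2 * \<alpha> * F \<theta> * P'' (r\<^sup>2) + 2 * (\<alpha> + \<delta>) * Z + \<beta> * F' \<theta> * X + \<delta> * Y"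
      unfolding G using a by (simp add: field_simps power2_eq_square)
    then show ?thesis by (simp add: X_def Y_def Z_def)
  qed
  finally have second: "\<sigma> * (\<Sum>i\<in>UNIV. \<Sum>j\<in>UNIV. A x $ i $ j * partial_deriv i (partial_deriv j u) x) \<le> \<dots>" .
  define br bt where "br = b x \<bullet> frame_vec \<theta> 1 0" and "bt = b x \<bullet> frame_vec \<theta> 0 1"
  have "b x \<bullet> (\<chi> i. partial_deriv i u x) = (\<Sum>j\<in>UNIV. frame_vec \<theta> br bt $ j * partial_deriv j u x)"
    using frame_vec_inner[of "b x" \<theta>] by (simp add: br_def bt_def inner_vec_def)
  then have first: "\<sigma> * (b x \<bullet> (\<chi> i. partial_deriv i u x))
      = F' \<theta> * P (r\<^sup>2) * bt / r + 2 * r * br * F \<theta> * P' (r\<^sup>2)"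
    using dir by simp
  have "\<sigma> * elliptic_op A b u x
      = - (\<sigma> * (\<Sum>i\<in>UNIV. \<Sum>j\<in>UNIV. A x $ i $ j * partial_deriv i (partial_deriv j u) x))
        + \<sigma> * (b x \<bullet> (\<chi> i. partial_deriv i u x))"
    by (simp add: elliptic_op_def algebra_simps)
  then show ?thesis
    using second unfolding first polar_op_def \<alpha>_def[symmetric] \<beta>_def[symmetric] \<delta>_def[symmetric]
      br_def[symmetric] bt_def[symmetric]
    by (simp add: mult_ac)
qed

section \<open>Barriers\<close>

text \<open>A function \<open>const - \<epsilon> e\<^bsup>\<kappa>\<rho>\<^esup>\<close> is a strict supersolution away from the origin once \<open>\<kappa>\<close> is large: the
  second derivative brings down \<open>\<kappa>\<^sup>2\<close> and the drift only \<open>\<kappa>\<close>.\<close>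

lemma polar_op_radial_exp_pos:
  assumes "0 < c0" "c0 \<le> \<alpha>" "c0 \<le> \<delta>" "\<bar>br\<bar> \<le> M2" "0 < r" "0 < \<kappa>" "0 < \<epsilon>" "M2 < 2 * \<kappa> * r * c0"
  shows "0 < polar_op \<alpha> \<beta> \<delta> br bt r 1 0 0 P (- \<epsilon> * \<kappa> * exp y) (- \<epsilon> * \<kappa>\<^sup>2 * exp y)"
proof -
  have "2 * \<kappa> * r * c0 \<le> 2 * \<kappa> * r * \<alpha>" using assms by (intro mult_left_mono) auto
  then have "0 < 2 * \<kappa> * r * \<alpha> - br" using assms by linarith
  then have 1: "0 < 2 * \<epsilon> * \<kappa> * exp y * r * (2 * \<kappa> * r * \<alpha> - br)" using assms by simp
  have "0 \<le> 2 * (\<alpha> + \<delta>) * (\<epsilon> * \<kappa> * exp y)" using assms by simp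
  moreover have "polar_op \<alpha> \<beta> \<delta> br bt r 1 0 0 P (- \<epsilon> * \<kappa> * exp y) (- \<epsilon> * \<kappa>\<^sup>2 * exp y)
     = 2 * \<epsilon> * \<kappa> * exp y * r * (2 * \<kappa> * r * \<alpha> - br) + 2 * (\<alpha> + \<delta>) * (\<epsilon> * \<kappa> * exp y)"
    by (simp add: polar_op_def power2_eq_square algebra_simps)
  ultimately show ?thesis using 1 by linarith
qed

text \<open>The hypothesis \<open>small\<close>, divided by \<open>d\<^sup>2\<close>, says that the gain \<open>4 r\<^sub>*\<^sup>2 c\<^sub>0 / d\<^sup>2\<close> from the concavity of the
  cap exceeds all other terms. These are estimated with \<open>|P'| \<le> 2/d\<close>, \<open>0 \<le> P \<le> 2\<close> and
  \<open>r\<^sub>*/2 \<le> r \<le> 2 r\<^sub>*\<close>. The angular factor enters only through \<open>|F'| \<le> F\<close> and \<open>F'' = F\<close>, so every positive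
  combination of \<open>e\<^sup>\<theta>\<close> and \<open>e\<^bsup>-\<theta>\<^esup>\<close> is admissible.\<close>

lemma polar_op_cap_pos:
  fixes rs d r F F' M1 M2 c0 \<alpha> \<beta> \<delta> br bt :: real
  defines "P \<equiv> 2 - ((r\<^sup>2 - rs\<^sup>2) / d)\<^sup>2" and "P' \<equiv> - 2 * (r\<^sup>2 - rs\<^sup>2) / d\<^sup>2"
  assumes c0: "0 < c0" and rs: "0 < rs" and d: "0 < d" "d \<le> rs\<^sup>2 / 2"
    and small: "(8 * M1 + 8 * rs * M2) * d + (8 * M1 / rs\<^sup>2 + 4 * M2 / rs) * d\<^sup>2 < 4 * rs\<^sup>2 * c0"
    and r: "0 < r" "\<bar>r\<^sup>2 - rs\<^sup>2\<bar> \<le> d" and F: "0 < F" "\<bar>F'\<bar> \<le> F"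
    and co: "c0 \<le> \<alpha>" "c0 \<le> \<delta>" "\<alpha> + \<delta> \<le> M1" "2 * \<bar>\<beta>\<bar> \<le> \<alpha> + \<delta>" "\<bar>br\<bar> \<le> M2" "\<bar>bt\<bar> \<le> M2"
  shows "0 < polar_op \<alpha> \<beta> \<delta> br bt r F F' F P P' (- 2 / d\<^sup>2)"
proof -
  have R: "rs\<^sup>2 > 0" using rs by simp
  have M: "0 \<le> M1" "0 \<le> M2" using co c0 by linarith+
  have r2: "rs\<^sup>2 / 2 \<le> r\<^sup>2" "r\<^sup>2 \<le> (3/2) * rs\<^sup>2" using r(2) d by linarith+
  have rl: "rs / 2 \<le> r"
  proof (rule power2_le_imp_le)
    have "(rs / 2)\<^sup>2 = rs\<^sup>2 / 4" by (simp add: power2_eq_square)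
    then show "(rs / 2)\<^sup>2 \<le> r\<^sup>2" using r2 R by linarith
  qed (use r in simp)
  have ru: "r \<le> 2 * rs"
  proof (rule power2_le_imp_le)
    have "(2 * rs)\<^sup>2 = 4 * rs\<^sup>2" by (simp add: power2_eq_square)
    then show "r\<^sup>2 \<le> (2 * rs)\<^sup>2" using r2 R by linarith
  qed (use rs in simp)
  have "\<bar>(r\<^sup>2 - rs\<^sup>2) / d\<bar> \<le> 1" using r(2) d by simp
  then have "((r\<^sup>2 - rs\<^sup>2) / d)\<^sup>2 \<le> 1" by (simp add: abs_square_le_1)
  then have P: "0 \<le> P" "P \<le> 2" by (auto simp: P_def)
  have P': "\<bar>P'\<bar> \<le> 2 / d"
    using r(2) d by (simp add: P'_def abs_mult power2_eq_square field_simps)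
  have Pr2: "P / r\<^sup>2 \<le> 4 / rs\<^sup>2"
    using frac_le[of 2 P "rs\<^sup>2 / 2" "r\<^sup>2"] P r2 R by simp
  have Pr: "P / r \<le> 4 / rs"
    using frac_le[of 2 P "rs / 2" "r"] P rl rs by simp
  have Pr0: "0 \<le> P / r" "0 \<le> P / r\<^sup>2" using P r by auto
  have t1: "4 * r\<^sup>2 * \<alpha> * F * (- 2 / d\<^sup>2) \<le> - (4 * rs\<^sup>2 * c0 / d\<^sup>2 * F)"
  proof -
    have "(rs\<^sup>2 / 2) * c0 * F \<le> r\<^sup>2 * \<alpha> * F"
      using r2 co c0 F R by (intro mult_mono) auto
    from mult_left_mono[OF this, of "8 / d\<^sup>2"] show ?thesis by (simp add: field_simps)
  qed
  have t2: "2 * (\<alpha> + \<delta>) * F * P' \<le> 2 * M1 * F * (2 / d)"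
  proof -
    have "2 * (\<alpha> + \<delta>) * F * P' \<le> 2 * (\<alpha> + \<delta>) * F * (2 / d)"
      using P' co c0 F by (intro mult_left_mono) auto
    also have "\<dots> \<le> 2 * M1 * F * (2 / d)"
      using d co F by (intro mult_right_mono) auto
    finally show ?thesis .
  qed
  have t3: "\<beta> * F' * (4 * P' - 2 * P / r\<^sup>2) \<le> (M1 / 2) * F * (8 / d + 8 / rs\<^sup>2)"
  proof -
    have "\<bar>4 * P' - 2 * P / r\<^sup>2\<bar> \<le> 4 * \<bar>P'\<bar> + 2 * (P / r\<^sup>2)" using Pr0 by simp
    also have "\<dots> \<le> 8 / d + 8 / rs\<^sup>2" using P' Pr2 by simp
    finally have "\<bar>\<beta>\<bar> * \<bar>F'\<bar> * \<bar>4 * P' - 2 * P / r\<^sup>2\<bar> \<le> (M1 / 2) * F * (8 / d + 8 / rs\<^sup>2)"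
      using co F M by (intro mult_mono) auto
    then show ?thesis by (simp add: abs_mult[symmetric])
  qed
  have t4: "\<delta> * F * P / r\<^sup>2 \<le> M1 * F * (4 / rs\<^sup>2)"
  proof -
    have "\<delta> * F * (P / r\<^sup>2) \<le> M1 * F * (4 / rs\<^sup>2)"
      using co c0 F M Pr0 Pr2 by (intro mult_mono) auto
    then show ?thesis by simp
  qed
  have t5: "- (2 * r * br * F * P') \<le> 2 * (2 * rs) * M2 * F * (2 / d)"
  proof -
    have "2 * r * \<bar>br\<bar> * F * \<bar>P'\<bar> \<le> 2 * (2 * rs) * M2 * F * (2 / d)"
      using co r ru rs F P' M by (intro mult_mono mult_nonneg_nonneg) auto
    moreover have "\<bar>2 * r * br * F * P'\<bar> = 2 * r * \<bar>br\<bar> * F * \<bar>P'\<bar>"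
      using r F by (simp add: abs_mult)
    ultimately show ?thesis by linarith
  qed
  have t6: "- (bt * F' * P / r) \<le> M2 * F * (4 / rs)"
  proof -
    have "\<bar>bt\<bar> * \<bar>F'\<bar> * (P / r) \<le> M2 * F * (4 / rs)"
      using co F M Pr Pr0 by (intro mult_mono) auto
    moreover have "\<bar>bt * F' * (P / r)\<bar> = \<bar>bt\<bar> * \<bar>F'\<bar> * (P / r)"
      using P r by (simp add: abs_mult)
    moreover have "bt * F' * P / r = bt * F' * (P / r)" by simp
    ultimately show ?thesis by linarith
  qed
  have "(8 * M1 + 8 * rs * M2) / d + (8 * M1 / rs\<^sup>2 + 4 * M2 / rs) < 4 * rs\<^sup>2 * c0 / d\<^sup>2"
  proof -
    have "(8 * M1 + 8 * rs * M2) / d + (8 * M1 / rs\<^sup>2 + 4 * M2 / rs)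
       = ((8 * M1 + 8 * rs * M2) * d + (8 * M1 / rs\<^sup>2 + 4 * M2 / rs) * d\<^sup>2) / d\<^sup>2"
      using d by (simp add: add_divide_distrib power2_eq_square)
    also have "\<dots> < 4 * rs\<^sup>2 * c0 / d\<^sup>2"
      using small d by (intro divide_strict_right_mono) auto
    finally show ?thesis .
  qed
  from mult_strict_right_mono[OF this F(1)]
  have "2 * M1 * F * (2 / d) + (M1 / 2) * F * (8 / d + 8 / rs\<^sup>2) + M1 * F * (4 / rs\<^sup>2)
     + 2 * (2 * rs) * M2 * F * (2 / d) + M2 * F * (4 / rs) < 4 * rs\<^sup>2 * c0 / d\<^sup>2 * F"
    by (simp add: add_divide_distrib algebra_simps)
  then show ?thesis
    using t1 t2 t3 t4 t5 t6 unfolding polar_op_def by linarith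
qed

section \<open>Comparison on a piece of the spiral\<close>

locale spiral_problem =
  fixes \<theta>0 rs c0 M1 M2 :: real
    and r1 r2 :: "real \<Rightarrow> real"
    and A :: "real ^ 2 \<Rightarrow> real ^ 2 ^ 2"
    and b :: "real ^ 2 \<Rightarrow> real ^ 2"
  assumes r1_cont: "continuous_on {\<theta>0..} r1"
    and r2_cont: "continuous_on {\<theta>0..} r2"
    and r1_pos: "\<And>\<theta>. \<theta> \<ge> \<theta>0 \<Longrightarrow> 0 < r1 \<theta>"
    and r_less: "\<And>\<theta>. \<theta> \<ge> \<theta>0 \<Longrightarrow> r1 \<theta> < r2 \<theta>"
    and rs_pos: "rs > 0"
    and r1_lim: "(r1 \<longlongrightarrow> rs) at_top"
    and r2_lim: "(r2 \<longlongrightarrow> rs) at_top"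
    and A_sym: "\<And>x. x \<in> spiral_open \<theta>0 r1 r2 \<Longrightarrow> transpose (A x) = A x"
    and c0_pos: "c0 > 0"
    and elliptic: "\<And>x \<xi>. x \<in> spiral_open \<theta>0 r1 r2 \<Longrightarrow> c0 * (norm \<xi>)\<^sup>2 \<le> \<xi> \<bullet> (A x *v \<xi>)"
    and trace_bound: "\<And>x. x \<in> spiral_open \<theta>0 r1 r2 \<Longrightarrow> trace (A x) \<le> M1"
    and drift_bound: "\<And>x. x \<in> spiral_open \<theta>0 r1 r2 \<Longrightarrow> norm (b x) \<le> M2"
begin

abbreviation "U \<equiv> spiral_open \<theta>0 r1 r2"
abbreviation "Ut \<equiv> spiral_closed \<theta>0 r1 r2"
abbreviation "\<gamma> \<equiv> spiral_sides \<theta>0 r1 r2"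
abbreviation "S \<equiv> cross_section r1 r2"

definition strip :: "real \<Rightarrow> real \<Rightarrow> (real \<times> real) set" where
  "strip s t = {(r, \<theta>). s \<le> \<theta> \<and> \<theta> \<le> t \<and> r1 \<theta> \<le> r \<and> r \<le> r2 \<theta>}"

text \<open>The parameter set is the image of a rectangle under linear interpolation between the two radii.\<close>

lemma compact_strip:
  assumes "\<theta>0 \<le> s"
  shows "compact (strip s t)"
proof -
  let ?h = "\<lambda>(l, \<theta>). ((1 - l) * r1 \<theta> + l * r2 \<theta>, \<theta>)"
  have sub: "{s..t} \<subseteq> {\<theta>0..}" using assms by auto
  have c: "continuous_on ({0..1} \<times> {s..t}) (\<lambda>z. r1 (snd z))"
    "continuous_on ({0..1} \<times> {s..t}) (\<lambda>z. r2 (snd z))"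
    by (auto intro!: continuous_on_compose2[OF continuous_on_subset[OF r1_cont sub]]
        continuous_on_compose2[OF continuous_on_subset[OF r2_cont sub]] continuous_intros)
  have "strip s t = ?h ` ({0..1} \<times> {s..t})"
  proof (intro equalityI subsetI)
    fix z assume "z \<in> strip s t"
    then obtain r \<theta> where z: "z = (r, \<theta>)" "s \<le> \<theta>" "\<theta> \<le> t" "r1 \<theta> \<le> r" "r \<le> r2 \<theta>"
      by (auto simp: strip_def)
    define l where "l = (r - r1 \<theta>) / (r2 \<theta> - r1 \<theta>)"
    have p: "r2 \<theta> - r1 \<theta> > 0" using r_less[of \<theta>] z assms by simp
    have "l * (r2 \<theta> - r1 \<theta>) = r - r1 \<theta>" using p by (simp add: l_def)
    then have "z = ?h (l, \<theta>)" by (simp add: z algebra_simps)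
    moreover have "0 \<le> l" "l \<le> 1" using z p by (auto simp: l_def)
    ultimately show "z \<in> ?h ` ({0..1} \<times> {s..t})" using z by (intro image_eqI[of _ _ "(l, \<theta>)"]) auto
  next
    fix z assume "z \<in> ?h ` ({0..1} \<times> {s..t})"
    then obtain l \<theta> where z: "z = ?h (l, \<theta>)" "0 \<le> l" "l \<le> 1" "s \<le> \<theta>" "\<theta> \<le> t" by auto
    have p: "r2 \<theta> - r1 \<theta> > 0" using r_less[of \<theta>] z assms by simp
    have "0 \<le> l * (r2 \<theta> - r1 \<theta>)" "0 \<le> (1 - l) * (r2 \<theta> - r1 \<theta>)" using p z by auto
    then show "z \<in> strip s t" using z by (auto simp: strip_def algebra_simps)
  qed
  moreover have "compact (?h ` ({0..1} \<times> {s..t}))"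
    unfolding case_prod_beta
    by (intro compact_continuous_image compact_Times compact_Icc continuous_intros c)
  ultimately show ?thesis by simp
qed

lemma polar_pt_in_closed: "(r, \<theta>) \<in> strip s t \<Longrightarrow> \<theta>0 \<le> s \<Longrightarrow> polar_pt r \<theta> \<in> Ut"
  unfolding strip_def spiral_closed_def by force

lemma polar_pt_in_open: "\<theta>0 < \<theta> \<Longrightarrow> r1 \<theta> < r \<Longrightarrow> r < r2 \<theta> \<Longrightarrow> polar_pt r \<theta> \<in> U"
  unfolding spiral_open_def by blast

lemma continuous_on_strip:
  assumes "\<theta>0 \<le> s" "continuous_on Ut u"
  shows "continuous_on (strip s t) (\<lambda>z. u (polar_pt (fst z) (snd z)))"
proof -
  have "polar_pt r \<theta> = (r * cos \<theta>) *\<^sub>R axis 1 1 + (r * sin \<theta>) *\<^sub>R axis 2 1" for r \<theta>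
    by (simp add: polar_pt_def vec_eq_iff forall_2 axis_def)
  then have "continuous_on (strip s t) (\<lambda>z. polar_pt (fst z) (snd z))"
    by (simp) (intro continuous_intros)
  then show ?thesis
    by (rule continuous_on_compose2[OF assms(2)]) (use polar_pt_in_closed assms(1) in auto)
qed

lemma eventually_line_in_strip:
  assumes th: "\<theta>0 \<le> s" "s < \<theta>" "\<theta> < t" and r: "r1 \<theta> < r" "r < r2 \<theta>"
  shows "\<forall>\<^sub>F \<tau> in nhds 0. 0 < r + \<tau> * p \<and>
     s < \<theta> + arctan (\<tau> * q / (r + \<tau> * p)) \<and> \<theta> + arctan (\<tau> * q / (r + \<tau> * p)) < t \<and>
     r1 (\<theta> + arctan (\<tau> * q / (r + \<tau> * p))) < sqrt ((r + \<tau> * p)\<^sup>2 + (\<tau> * q)\<^sup>2) \<and>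
     sqrt ((r + \<tau> * p)\<^sup>2 + (\<tau> * q)\<^sup>2) < r2 (\<theta> + arctan (\<tau> * q / (r + \<tau> * p)))"
proof -
  let ?a = "\<lambda>\<tau>. \<theta> + arctan (\<tau> * q / (r + \<tau> * p))"
  let ?r = "\<lambda>\<tau>. sqrt ((r + \<tau> * p)\<^sup>2 + (\<tau> * q)\<^sup>2)"
  have r0: "r > 0" using r1_pos[of \<theta>] th r by simp
  have i: "((\<lambda>\<tau>. \<tau>) \<longlongrightarrow> 0) (nhds (0::real))" by (simp add: filterlim_def)
  have l: "((\<lambda>\<tau>. r + \<tau> * p) \<longlongrightarrow> r + 0 * p) (nhds 0)"
    by (intro tendsto_add tendsto_mult tendsto_const i)
  have a: "(?a \<longlongrightarrow> \<theta> + arctan (0 * q / (r + 0 * p))) (nhds 0)"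
    using r0 by (intro tendsto_add tendsto_arctan tendsto_divide tendsto_mult tendsto_const i) auto
  then have a: "(?a \<longlongrightarrow> \<theta>) (nhds 0)" by simp
  have "(?r \<longlongrightarrow> sqrt ((r + 0 * p)\<^sup>2 + (0 * q)\<^sup>2)) (nhds 0)"
    by (intro tendsto_real_sqrt tendsto_power tendsto_add tendsto_mult tendsto_const i)
  then have rr: "(?r \<longlongrightarrow> r) (nhds 0)" using r0 by simp
  have in_int: "\<theta> \<in> interior {\<theta>0..}" using th by (simp add: interior_real_atLeast)
  have c1: "((\<lambda>\<tau>. r1 (?a \<tau>)) \<longlongrightarrow> r1 \<theta>) (nhds 0)"
    using continuous_on_interior[OF r1_cont in_int] a by (rule isCont_tendsto_compose)
  have c2: "((\<lambda>\<tau>. r2 (?a \<tau>)) \<longlongrightarrow> r2 \<theta>) (nhds 0)"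
    using continuous_on_interior[OF r2_cont in_int] a by (rule isCont_tendsto_compose)
  have "((\<lambda>\<tau>. ?r \<tau> - r1 (?a \<tau>)) \<longlongrightarrow> r - r1 \<theta>) (nhds 0)"
    "((\<lambda>\<tau>. r2 (?a \<tau>) - ?r \<tau>) \<longlongrightarrow> r2 \<theta> - r) (nhds 0)"
    by (intro tendsto_diff c1 c2 rr)+
  then have "\<forall>\<^sub>F \<tau> in nhds 0. 0 < ?r \<tau> - r1 (?a \<tau>)" "\<forall>\<^sub>F \<tau> in nhds 0. 0 < r2 (?a \<tau>) - ?r \<tau>"
    using r by (auto dest!: order_tendstoD(1)[where a = 0])
  moreover have "\<forall>\<^sub>F \<tau> in nhds 0. s < ?a \<tau>" "\<forall>\<^sub>F \<tau> in nhds 0. ?a \<tau> < t"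
    using order_tendstoD[OF a] th by auto
  moreover have "\<forall>\<^sub>F \<tau> in nhds 0. 0 < r + \<tau> * p"
    using order_tendstoD(1)[OF l, of 0] r0 by simp
  ultimately show ?thesis by eventually_elim auto
qed

text \<open>A strict supersolution that dominates \<open>\<sigma> u\<close> on the boundary of a piece of the spiral dominates it
  inside: a maximum of the difference at an interior parameter would give
  \<open>0 < L w \<le> \<sigma> L u \<le> 0\<close>. The hypothesis \<open>super\<close> asks for positivity under all coefficients that the
  structural bounds allow, which makes it independent of the particular operator.\<close>

lemma comparison:
  fixes F F' F'' P P' P'' :: "real \<Rightarrow> real" and \<sigma> :: real
  assumes st: "\<theta>0 \<le> s"
    and u: "C2_on U u" "continuous_on Ut u"
    and sub: "\<And>x. x \<in> U \<Longrightarrow> \<sigma> * elliptic_op A b u x \<le> 0"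
    and sides: "\<And>x. x \<in> \<gamma> \<Longrightarrow> \<sigma> * u x \<le> 0"
    and F: "\<And>y. (F has_real_derivative F' y) (at y)" and F': "\<And>y. (F' has_real_derivative F'' y) (at y)"
    and P: "\<And>y. (P has_real_derivative P' y) (at y)" and P': "\<And>y. (P' has_real_derivative P'' y) (at y)"
    and super: "\<And>r \<theta> \<alpha> \<beta> \<delta> br bt. \<lbrakk>(r, \<theta>) \<in> strip s t; c0 \<le> \<alpha>; c0 \<le> \<delta>; \<alpha> + \<delta> \<le> M1;
        2 * \<bar>\<beta>\<bar> \<le> \<alpha> + \<delta>; \<bar>br\<bar> \<le> M2; \<bar>bt\<bar> \<le> M2\<rbrakk>
      \<Longrightarrow> 0 < polar_op \<alpha> \<beta> \<delta> br bt r (F \<theta>) (F' \<theta>) (F'' \<theta>) (P (r\<^sup>2)) (P' (r\<^sup>2)) (P'' (r\<^sup>2))"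
    and nonneg: "\<And>r \<theta>. (r, \<theta>) \<in> strip s t \<Longrightarrow> 0 \<le> F \<theta> * P (r\<^sup>2)"
    and ends: "\<And>r. r1 s \<le> r \<Longrightarrow> r \<le> r2 s \<Longrightarrow> \<sigma> * u (polar_pt r s) \<le> F s * P (r\<^sup>2)"
      "\<And>r. r1 t \<le> r \<Longrightarrow> r \<le> r2 t \<Longrightarrow> \<sigma> * u (polar_pt r t) \<le> F t * P (r\<^sup>2)"
    and z: "(r, \<theta>) \<in> strip s t"
  shows "\<sigma> * u (polar_pt r \<theta>) \<le> F \<theta> * P (r\<^sup>2)"
proof -
  define V where "V = (\<lambda>z. \<sigma> * u (polar_pt (fst z) (snd z)) - F (snd z) * P ((fst z)\<^sup>2))"
  have contF: "continuous_on UNIV F" "continuous_on UNIV P"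
    using F P DERIV_isCont by (blast intro: continuous_at_imp_continuous_on)+
  have "continuous_on (strip s t) V"
    unfolding V_def
    by (intro continuous_intros continuous_on_strip st u
        continuous_on_compose2[OF contF(1)] continuous_on_compose2[OF contF(2)]) auto
  then obtain r' \<theta>' where m: "(r', \<theta>') \<in> strip s t" "\<And>z. z \<in> strip s t \<Longrightarrow> V z \<le> V (r', \<theta>')"
    using continuous_attains_sup[OF compact_strip[OF st]] z by (metis empty_iff surj_pair)
  have "V (r', \<theta>') \<le> 0"
  proof (cases "s < \<theta>' \<and> \<theta>' < t \<and> r1 \<theta>' < r' \<and> r' < r2 \<theta>'")
    case False
    then consider "\<theta>' = s" | "\<theta>' = t" | "r' = r1 \<theta>'" | "r' = r2 \<theta>'"
      using m(1) by (fastforce simp: strip_def)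
    then show ?thesis
    proof cases
      case 1 then show ?thesis using ends(1)[of r'] m(1) by (simp add: V_def strip_def)
    next
      case 2 then show ?thesis using ends(2)[of r'] m(1) by (simp add: V_def strip_def)
    next
      case 3
      then have "polar_pt r' \<theta>' \<in> \<gamma>" using m(1) st by (force simp: strip_def spiral_sides_def)
      then show ?thesis using sides nonneg[OF m(1)] by (fastforce simp: V_def)
    next
      case 4
      then have "polar_pt r' \<theta>' \<in> \<gamma>" using m(1) st by (force simp: strip_def spiral_sides_def)
      then show ?thesis using sides nonneg[OF m(1)] by (fastforce simp: V_def)
    qed
  next
    case True
    let ?x = "polar_pt r' \<theta>'"
    have r': "r' > 0" using True r1_pos[of \<theta>'] st by simp
    have x: "?x \<in> U" using True st by (intro polar_pt_in_open) auto
    note el = polar_elliptic[OF A_sym[OF x] c0_pos elliptic[OF x], of \<theta>']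
    have touch: "\<forall>\<^sub>F \<tau> in nhds 0. ?x + \<tau> *\<^sub>R frame_vec \<theta>' p q \<in> U \<and>
       \<sigma> * u (?x + \<tau> *\<^sub>R frame_vec \<theta>' p q)
         - F (\<theta>' + arctan (\<tau> * q / (r' + \<tau> * p))) * P ((r' + \<tau> * p)\<^sup>2 + (\<tau> * q)\<^sup>2)
       \<le> \<sigma> * u ?x - F \<theta>' * P (r'\<^sup>2)" for p q
      \<comment> \<open>near the maximum the line lifts into the parameter set, so its points compete with the maximum\<close>
      using eventually_line_in_strip[of s \<theta>' t r' p q] True st
    proof (elim conjE, simp only: simp_thms True_implies_equals, elim eventually_mono, goal_cases)
      case (1 \<tau>)
      let ?r = "sqrt ((r' + \<tau> * p)\<^sup>2 + (\<tau> * q)\<^sup>2)" and ?a = "\<theta>' + arctan (\<tau> * q / (r' + \<tau> * p))"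
      have pt: "polar_pt ?r ?a = ?x + \<tau> *\<^sub>R frame_vec \<theta>' p q"
        using polar_pt_lift[of "r' + \<tau> * p" "\<tau> * q" \<theta>'] 1 by (simp add: frame_vec_line)
      have "polar_pt ?r ?a \<in> U" using 1 st by (intro polar_pt_in_open) auto
      moreover have "V (?r, ?a) \<le> V (r', \<theta>')" using 1 by (intro m(2)) (auto simp: strip_def)
      ultimately show ?case by (simp add: V_def pt)
    qed
    have br: "\<bar>b ?x \<bullet> frame_vec \<theta>' p q\<bar> \<le> M2" if "p\<^sup>2 + q\<^sup>2 = 1" for p q
    proof -
      have "norm (frame_vec \<theta>' p q) = 1"
        using norm_frame_vec[of \<theta>' p q] that by (simp add: power2_eq_1_iff) (smt (verit) norm_ge_zero)
      then show ?thesis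
        using Cauchy_Schwarz_ineq2[of "b ?x" "frame_vec \<theta>' p q"] drift_bound[OF x] by simp
    qed
    have "0 < \<sigma> * elliptic_op A b u ?x"
      by (rule less_le_trans[OF super operator_at_touching_point[where F = F and P = P and A = A and b = b and \<sigma> = \<sigma> and u = u, OF r' u(1) x F F' P P' touch A_sym[OF x] c0_pos elliptic[OF x]]])
         (use m(1) el trace_bound[OF x] br polar_trace[of "A ?x" \<theta>'] in auto)
    then show ?thesis using sub[OF x] by simp
  qed
  then show ?thesis using m(2)[OF z] by (simp add: V_def)
qed

text \<open>Comparison with the constant \<open>m\<close>, made strict by a small multiple of \<open>E - e\<^bsup>\<kappa>\<rho>\<^esup>\<close>. A compact piece of the
  spiral keeps a positive distance from the origin, so a suitable \<open>\<kappa>\<close> exists; it may depend on the piece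
  because the perturbation tends to zero in the end.\<close>

lemma maximum_principle:
  fixes \<sigma> :: real
  assumes s: "\<theta>0 \<le> s"
    and u: "C2_on U u" "continuous_on Ut u"
    and sub: "\<And>x. x \<in> U \<Longrightarrow> \<sigma> * elliptic_op A b u x \<le> 0"
    and sides: "\<And>x. x \<in> \<gamma> \<Longrightarrow> \<sigma> * u x \<le> 0"
    and m: "0 \<le> m"
    and ends: "\<And>r. r1 s \<le> r \<Longrightarrow> r \<le> r2 s \<Longrightarrow> \<sigma> * u (polar_pt r s) \<le> m"
      "\<And>r. r1 t \<le> r \<Longrightarrow> r \<le> r2 t \<Longrightarrow> \<sigma> * u (polar_pt r t) \<le> m"
    and z: "(r, \<theta>) \<in> strip s t"
  shows "\<sigma> * u (polar_pt r \<theta>) \<le> m"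
proof -
  have ne: "strip s t \<noteq> {}" using z by auto
  have cf: "continuous_on (strip s t) fst" by (intro continuous_intros)
  obtain z0 where z0: "z0 \<in> strip s t" "\<And>z. z \<in> strip s t \<Longrightarrow> fst z0 \<le> fst z"
    using continuous_attains_inf[OF compact_strip[OF s] ne cf] by auto
  obtain z1 where z1: "z1 \<in> strip s t" "\<And>z. z \<in> strip s t \<Longrightarrow> fst z \<le> fst z1"
    using continuous_attains_sup[OF compact_strip[OF s] ne cf] by auto
  define \<rho>0 where "\<rho>0 = fst z0"
  have r0: "0 < \<rho>0"
    using z0(1) s r1_pos[of "snd z0"] unfolding \<rho>0_def strip_def by fastforce
  have lower: "\<rho>0 \<le> r" if "(r, \<theta>) \<in> strip s t" for r \<theta>
    using z0(2)[OF that] by (simp add: \<rho>0_def)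
  define \<kappa> where "\<kappa> = (\<bar>M2\<bar> + 1) / (2 * \<rho>0 * c0)"
  have k: "0 < \<kappa>" "2 * \<kappa> * \<rho>0 * c0 = \<bar>M2\<bar> + 1"
    using r0 c0_pos by (auto simp: \<kappa>_def intro!: divide_pos_pos)
  define E where "E = exp (\<kappa> * (fst z1)\<^sup>2)"
  have E: "0 < E" by (simp add: E_def)
  have le_E: "exp (\<kappa> * r\<^sup>2) \<le> E" if "(r, \<theta>) \<in> strip s t" for r \<theta>
    using z1(2)[OF that] lower[OF that] r0 k(1) unfolding E_def by (simp add: power_mono)
  have perturbed: "\<sigma> * u (polar_pt r \<theta>) \<le> m + \<epsilon> * E" if \<epsilon>: "\<epsilon> > 0" for \<epsilon>
  proof -
    define P where "P = (\<lambda>y. m + \<epsilon> * (E - exp (\<kappa> * y)))"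
    have P_ge: "m \<le> P (r\<^sup>2)" if "(r, \<theta>) \<in> strip s t" for r \<theta>
      using le_E[OF that] \<epsilon> by (simp add: P_def)
    have "\<sigma> * u (polar_pt r \<theta>) \<le> 1 * P (r\<^sup>2)"
    proof (rule comparison[where F = "\<lambda>_. 1" and F' = "\<lambda>_. 0" and F'' = "\<lambda>_. 0" and P = P
          and P' = "\<lambda>y. - \<epsilon> * \<kappa> * exp (\<kappa> * y)" and P'' = "\<lambda>y. - \<epsilon> * \<kappa>\<^sup>2 * exp (\<kappa> * y)", OF s u sub sides])
      show "(P has_real_derivative - \<epsilon> * \<kappa> * exp (\<kappa> * y)) (at y)" for y
        unfolding P_def by (auto intro!: derivative_eq_intros)
      show "((\<lambda>y. - \<epsilon> * \<kappa> * exp (\<kappa> * y)) has_real_derivative - \<epsilon> * \<kappa>\<^sup>2 * exp (\<kappa> * y)) (at y)" for y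
        by (auto intro!: derivative_eq_intros simp: power2_eq_square)
    next
      fix r \<theta> \<alpha> \<beta> \<delta> br bt
      assume h: "(r, \<theta>) \<in> strip s t" "c0 \<le> \<alpha>" "c0 \<le> \<delta>" "\<bar>br\<bar> \<le> M2"
      have "\<bar>M2\<bar> + 1 \<le> 2 * \<kappa> * r * c0"
        unfolding k(2)[symmetric] using lower[OF h(1)] k(1) c0_pos by simp
      then show "0 < polar_op \<alpha> \<beta> \<delta> br bt r 1 0 0 (P (r\<^sup>2)) (- \<epsilon> * \<kappa> * exp (\<kappa> * r\<^sup>2))
          (- \<epsilon> * \<kappa>\<^sup>2 * exp (\<kappa> * r\<^sup>2))"
        using h c0_pos k(1) \<epsilon> lower[OF h(1)] r0 by (intro polar_op_radial_exp_pos) auto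
    next
      show "0 \<le> 1 * P (r\<^sup>2)" if "(r, \<theta>) \<in> strip s t" for r \<theta>
        using P_ge[OF that] m by simp
    next
      fix r assume r: "r1 s \<le> r" "r \<le> r2 s"
      have "(r, s) \<in> strip s t" using r z by (auto simp: strip_def)
      from P_ge[OF this] show "\<sigma> * u (polar_pt r s) \<le> 1 * P (r\<^sup>2)" using ends(1)[OF r] by simp
    next
      fix r assume r: "r1 t \<le> r" "r \<le> r2 t"
      have "(r, t) \<in> strip s t" using r z by (auto simp: strip_def)
      from P_ge[OF this] show "\<sigma> * u (polar_pt r t) \<le> 1 * P (r\<^sup>2)" using ends(2)[OF r] by simp
    qed (use z in simp_all)
    also have "1 * P (r\<^sup>2) \<le> m + \<epsilon> * E" using \<epsilon> by (simp add: P_def)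
    finally show ?thesis .
  qed
  show ?thesis
  proof (rule field_le_epsilon)
    fix e :: real assume "e > 0"
    then show "\<sigma> * u (polar_pt r \<theta>) \<le> m + e" using perturbed[of "e / E"] E by simp
  qed
qed

text \<open>The left-hand side tends to zero with \<open>d\<close>.\<close>

lemma exists_cap_width:
  "\<exists>d>0. d \<le> rs\<^sup>2 / 2 \<and>
     (8 * M1 + 8 * rs * M2) * d + (8 * M1 / rs\<^sup>2 + 4 * M2 / rs) * d\<^sup>2 < 4 * rs\<^sup>2 * c0"
proof -
  have "((\<lambda>d. (8 * M1 + 8 * rs * M2) * d + (8 * M1 / rs\<^sup>2 + 4 * M2 / rs) * d\<^sup>2) \<longlongrightarrow>
      (8 * M1 + 8 * rs * M2) * 0 + (8 * M1 / rs\<^sup>2 + 4 * M2 / rs) * 0\<^sup>2) (at_right 0)"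
    by (intro tendsto_intros)
  then have "\<forall>\<^sub>F d in at_right 0. (8 * M1 + 8 * rs * M2) * d + (8 * M1 / rs\<^sup>2 + 4 * M2 / rs) * d\<^sup>2
      < 4 * rs\<^sup>2 * c0"
    by (rule order_tendstoD(2)) (use rs_pos c0_pos in simp)
  moreover have "\<forall>\<^sub>F d in at_right 0. d < rs\<^sup>2 / 2"
    by (rule order_tendstoD(2)[OF tendsto_ident_at]) (use rs_pos in simp)
  moreover have "\<forall>\<^sub>F d in at_right (0::real). 0 < d" by (rule eventually_at_right_less)
  ultimately have "\<forall>\<^sub>F d in at_right 0. 0 < d \<and> d \<le> rs\<^sup>2 / 2 \<and>
     (8 * M1 + 8 * rs * M2) * d + (8 * M1 / rs\<^sup>2 + 4 * M2 / rs) * d\<^sup>2 < 4 * rs\<^sup>2 * c0"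
    by eventually_elim auto
  then show ?thesis
    using eventually_happens'[OF trivial_limit_at_right_real] by blast
qed

lemma eventually_near_limit_circle:
  assumes "d > 0"
  shows "\<exists>T\<ge>\<theta>0. \<forall>\<theta>\<ge>T. \<forall>r. r1 \<theta> \<le> r \<longrightarrow> r \<le> r2 \<theta> \<longrightarrow> \<bar>r\<^sup>2 - rs\<^sup>2\<bar> \<le> d"
proof -
  have "((\<lambda>\<theta>. (r1 \<theta>)\<^sup>2) \<longlongrightarrow> rs\<^sup>2) at_top" "((\<lambda>\<theta>. (r2 \<theta>)\<^sup>2) \<longlongrightarrow> rs\<^sup>2) at_top"
    by (intro tendsto_power r1_lim r2_lim)+
  then have "\<forall>\<^sub>F \<theta> in at_top. rs\<^sup>2 - d < (r1 \<theta>)\<^sup>2" "\<forall>\<^sub>F \<theta> in at_top. (r2 \<theta>)\<^sup>2 < rs\<^sup>2 + d"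
    using assms by (auto intro: order_tendstoD)
  then have "\<forall>\<^sub>F \<theta> in at_top. \<theta>0 \<le> \<theta> \<and> rs\<^sup>2 - d < (r1 \<theta>)\<^sup>2 \<and> (r2 \<theta>)\<^sup>2 < rs\<^sup>2 + d"
    using eventually_ge_at_top[of \<theta>0] by eventually_elim auto
  then obtain T where T: "\<And>\<theta>. \<theta> \<ge> T \<Longrightarrow> \<theta>0 \<le> \<theta> \<and> rs\<^sup>2 - d < (r1 \<theta>)\<^sup>2 \<and> (r2 \<theta>)\<^sup>2 < rs\<^sup>2 + d"
    by (auto simp: eventually_at_top_linorder)
  have "\<bar>r\<^sup>2 - rs\<^sup>2\<bar> \<le> d" if "\<theta> \<ge> T" "r1 \<theta> \<le> r" "r \<le> r2 \<theta>" for \<theta> r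
  proof -
    have "0 < r1 \<theta>" using T[OF that(1)] r1_pos by simp
    then have "(r1 \<theta>)\<^sup>2 \<le> r\<^sup>2" "r\<^sup>2 \<le> (r2 \<theta>)\<^sup>2" using that by (auto intro: power_mono)
    then show ?thesis using T[OF that(1)] by linarith
  qed
  then show ?thesis using T by blast
qed

text \<open>From the angle \<open>T\<close> on the spiral lies in an annulus thin enough for the cap barrier. The condition
  does not mention \<open>u\<close>, which is why the constants of the theorem are uniform.\<close>

definition narrow_from :: "real \<Rightarrow> bool" where
  "narrow_from T \<longleftrightarrow> \<theta>0 \<le> T \<and> (\<exists>d>0. d \<le> rs\<^sup>2 / 2 \<and>
     (8 * M1 + 8 * rs * M2) * d + (8 * M1 / rs\<^sup>2 + 4 * M2 / rs) * d\<^sup>2 < 4 * rs\<^sup>2 * c0 \<and>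
     (\<forall>\<theta>\<ge>T. \<forall>r. r1 \<theta> \<le> r \<longrightarrow> r \<le> r2 \<theta> \<longrightarrow> \<bar>r\<^sup>2 - rs\<^sup>2\<bar> \<le> d))"

lemma exists_narrow_from: "\<exists>T. narrow_from T"
  using exists_cap_width eventually_near_limit_circle unfolding narrow_from_def by metis

text \<open>A bound at either end of a piece in the thin annulus is felt inside only with an exponential
  discount. The barrier is the cap times \<open>ms e\<^bsup>s-\<theta>\<^esup> + mt e\<^bsup>\<theta>-t\<^esup>\<close>; the factor \<open>2\<close> is the upper bound of the
  cap, whose lower bound \<open>1\<close> takes care of the ends.\<close>

lemma two_sided_decay:
  fixes \<sigma> s t ms mt r \<theta> :: real
  assumes T: "narrow_from T" and s: "T \<le> s"
    and u: "C2_on U u" "continuous_on Ut u"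
    and sub: "\<And>x. x \<in> U \<Longrightarrow> \<sigma> * elliptic_op A b u x \<le> 0"
    and sides: "\<And>x. x \<in> \<gamma> \<Longrightarrow> \<sigma> * u x \<le> 0"
    and m: "0 \<le> ms" "0 \<le> mt"
    and ends: "\<And>r. r1 s \<le> r \<Longrightarrow> r \<le> r2 s \<Longrightarrow> \<sigma> * u (polar_pt r s) \<le> ms"
      "\<And>r. r1 t \<le> r \<Longrightarrow> r \<le> r2 t \<Longrightarrow> \<sigma> * u (polar_pt r t) \<le> mt"
    and z: "(r, \<theta>) \<in> strip s t"
  shows "\<sigma> * u (polar_pt r \<theta>) \<le> 2 * (ms * exp (s - \<theta>) + mt * exp (\<theta> - t))"
proof -
  obtain d where d: "d > 0" "d \<le> rs\<^sup>2 / 2"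
      "(8 * M1 + 8 * rs * M2) * d + (8 * M1 / rs\<^sup>2 + 4 * M2 / rs) * d\<^sup>2 < 4 * rs\<^sup>2 * c0"
    and near: "\<And>\<theta> r. \<lbrakk>\<theta> \<ge> T; r1 \<theta> \<le> r; r \<le> r2 \<theta>\<rbrakk> \<Longrightarrow> \<bar>r\<^sup>2 - rs\<^sup>2\<bar> \<le> d"
    using T unfolding narrow_from_def by blast
  have T0: "\<theta>0 \<le> T" using T unfolding narrow_from_def by blast
  define P where "P = (\<lambda>y. 2 - ((y - rs\<^sup>2) / d)\<^sup>2)"
  have P: "1 \<le> P (r\<^sup>2)" "P (r\<^sup>2) \<le> 2" if "\<theta> \<ge> T" "r1 \<theta> \<le> r" "r \<le> r2 \<theta>" for \<theta> r
  proof -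
    have "\<bar>(r\<^sup>2 - rs\<^sup>2) / d\<bar> \<le> 1" using near[OF that] d(1) by simp
    then have "((r\<^sup>2 - rs\<^sup>2) / d)\<^sup>2 \<le> 1" by (simp add: abs_square_le_1)
    then show "1 \<le> P (r\<^sup>2)" "P (r\<^sup>2) \<le> 2" by (auto simp: P_def)
  qed
  have perturbed: "\<sigma> * u (polar_pt r \<theta>) \<le> 2 * (ms * exp (s - \<theta>) + mt * exp (\<theta> - t)) + \<epsilon>"
    if \<epsilon>: "\<epsilon> > 0" for \<epsilon>
  proof -
    \<comment> \<open>the summand \<open>\<epsilon> / 2\<close> keeps the barrier strict when both end values vanish\<close>
    define F where "F = (\<lambda>y. (ms + \<epsilon> / 2) * exp (s - y) + mt * exp (y - t))"
    define F' where "F' = (\<lambda>y. - (ms + \<epsilon> / 2) * exp (s - y) + mt * exp (y - t))"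
    have F_pos: "0 < F y" for y
      unfolding F_def using m \<epsilon> by (intro add_pos_nonneg mult_pos_pos add_nonneg_pos) auto
    have "0 \<le> (ms + \<epsilon> / 2) * exp (s - y)" "0 \<le> mt * exp (y - t)" for y using m \<epsilon> by auto
    then have F': "\<bar>F' y\<bar> \<le> F y" for y
      unfolding F_def F'_def minus_mult_left[symmetric] by (smt (verit))
    have "\<sigma> * u (polar_pt r \<theta>) \<le> F \<theta> * P (r\<^sup>2)"
    proof (rule comparison[where F = F and F' = F' and F'' = F and P = P
          and P' = "\<lambda>y. - 2 * (y - rs\<^sup>2) / d\<^sup>2" and P'' = "\<lambda>_. - 2 / d\<^sup>2" and t = t, OF _ u])
      show "\<theta>0 \<le> s" using s T0 by simp
      show "\<sigma> * elliptic_op A b u x \<le> 0" if "x \<in> U" for x by (rule sub[OF that])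
      show "\<sigma> * u x \<le> 0" if "x \<in> \<gamma>" for x by (rule sides[OF that])
      show "(F has_real_derivative F' y) (at y)" for y
        unfolding F_def F'_def by (auto intro!: derivative_eq_intros simp: algebra_simps)
      show "(F' has_real_derivative F y) (at y)" for y
        unfolding F_def F'_def by (auto intro!: derivative_eq_intros simp: algebra_simps)
      show "(P has_real_derivative - 2 * (y - rs\<^sup>2) / d\<^sup>2) (at y)" for y
        unfolding P_def using d(1)
        by (auto intro!: derivative_eq_intros simp: power2_eq_square field_simps)
      show "((\<lambda>y. - 2 * (y - rs\<^sup>2) / d\<^sup>2) has_real_derivative - 2 / d\<^sup>2) (at y)" for y
        by (rule DERIV_cdivide) (auto intro!: derivative_eq_intros)
    next
      fix r \<theta> \<alpha> \<beta> \<delta> br bt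
      assume h: "(r, \<theta>) \<in> strip s t" "c0 \<le> \<alpha>" "c0 \<le> \<delta>" "\<alpha> + \<delta> \<le> M1" "2 * \<bar>\<beta>\<bar> \<le> \<alpha> + \<delta>"
        "\<bar>br\<bar> \<le> M2" "\<bar>bt\<bar> \<le> M2"
      have th: "\<theta> \<ge> T" "r1 \<theta> \<le> r" "r \<le> r2 \<theta>" using h(1) s by (auto simp: strip_def)
      have "0 < r" using r1_pos[of \<theta>] th T0 by simp
      then show "0 < polar_op \<alpha> \<beta> \<delta> br bt r (F \<theta>) (F' \<theta>) (F \<theta>) (P (r\<^sup>2))
          (- 2 * (r\<^sup>2 - rs\<^sup>2) / d\<^sup>2) (- 2 / d\<^sup>2)"
        unfolding P_def using h(2-) near[OF th]
        by (intro polar_op_cap_pos[OF c0_pos rs_pos d] F_pos F')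
    next
      show "0 \<le> F \<theta> * P (r\<^sup>2)" if "(r, \<theta>) \<in> strip s t" for r \<theta>
        using P(1)[of \<theta> r] F_pos[of \<theta>] that s by (auto simp: strip_def)
    next
      fix r assume r: "r1 s \<le> r" "r \<le> r2 s"
      have "\<sigma> * u (polar_pt r s) \<le> F s * 1"
        using ends(1) r m \<epsilon> by (force simp: F_def intro: order_trans add_increasing2)
      also have "\<dots> \<le> F s * P (r\<^sup>2)"
        using P(1)[OF s r] F_pos[of s] by (intro mult_left_mono) auto
      finally show "\<sigma> * u (polar_pt r s) \<le> F s * P (r\<^sup>2)" .
    next
      fix r assume r: "r1 t \<le> r" "r \<le> r2 t"
      have t: "T \<le> t" using s z by (auto simp: strip_def)
      have "mt \<le> F t" unfolding F_def using m \<epsilon> by simp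
      then have "\<sigma> * u (polar_pt r t) \<le> F t * 1" using ends(2) r by force
      also have "\<dots> \<le> F t * P (r\<^sup>2)"
        using P(1)[OF t r] F_pos[of t] by (intro mult_left_mono) auto
      finally show "\<sigma> * u (polar_pt r t) \<le> F t * P (r\<^sup>2)" .
    qed (rule z)
    also have "F \<theta> * P (r\<^sup>2) \<le> F \<theta> * 2"
      using P(2)[of \<theta> r] z s F_pos[of \<theta>] by (intro mult_left_mono) (auto simp: strip_def)
    also have "\<dots> = 2 * (ms * exp (s - \<theta>) + mt * exp (\<theta> - t)) + \<epsilon> * exp (s - \<theta>)"
      by (simp add: F_def algebra_simps)
    also have "\<dots> \<le> 2 * (ms * exp (s - \<theta>) + mt * exp (\<theta> - t)) + \<epsilon>"
      using z \<epsilon> by (simp add: strip_def)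
    finally show ?thesis .
  qed
  then show ?thesis by (rule field_le_epsilon)
qed

lemma SUP_cross_section_le_iff:
  fixes g :: "real ^ 2 \<Rightarrow> real"
  assumes "continuous_on Ut g" "\<theta>0 \<le> \<theta>"
  shows "(SUP x\<in>S \<theta>. g x) \<le> M \<longleftrightarrow> (\<forall>r. r1 \<theta> \<le> r \<longrightarrow> r \<le> r2 \<theta> \<longrightarrow> g (polar_pt r \<theta>) \<le> M)"
proof -
  have "S \<theta> \<subseteq> Ut" using assms(2) by (auto simp: cross_section_def spiral_closed_def)
  then obtain x where x: "x \<in> S \<theta>" "g x = (SUP y\<in>S \<theta>. g y)" "\<forall>y\<in>S \<theta>. g y \<le> g x"
    using cross_section_max[of r1 \<theta> r2 g] continuous_on_subset[OF assms(1)] r_less[OF assms(2)]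
    by (meson less_imp_le)
  have "g x \<le> M \<longleftrightarrow> (\<forall>y\<in>S \<theta>. g y \<le> M)" using x by (auto intro: order_trans)
  then show ?thesis unfolding x(2) by (auto simp: cross_section_def)
qed

end

section \<open>The dichotomy\<close>

text \<open>Here \<open>m\<close> is the function of cross-sectional maxima. In the two-sided bound the term coming from \<open>t\<close>
  can be made negligible by a choice of \<open>t\<close> unless \<open>m\<close> grows like \<open>e\<^sup>t\<close>; once \<open>m\<close> is known to decay, the
  maximum principle with \<open>t\<close> far away leaves only the value at \<open>\<theta>\<^sub>0\<close>.\<close>

lemma decay_or_growth:
  fixes m :: "real \<Rightarrow> real"
  assumes T: "\<theta>0 \<le> T" and nonneg: "\<And>\<theta>. \<theta> \<ge> \<theta>0 \<Longrightarrow> 0 \<le> m \<theta>"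
    and mp: "\<And>\<theta> t. \<lbrakk>\<theta>0 \<le> \<theta>; \<theta> \<le> t\<rbrakk> \<Longrightarrow> m \<theta> \<le> max (m \<theta>0) (m t)"
    and two: "\<And>\<theta> t. \<lbrakk>T \<le> \<theta>; \<theta> \<le> t\<rbrakk> \<Longrightarrow> m \<theta> \<le> 2 * (m T * exp (T - \<theta>) + m t * exp (\<theta> - t))"
  shows "(\<forall>\<theta>\<ge>\<theta>0. m \<theta> \<le> m \<theta>0 \<and> m \<theta> \<le> 2 * exp (T - \<theta>0) * m \<theta>0 * exp (\<theta>0 - \<theta>)) \<or>
    (\<exists>C>0. \<exists>\<theta>1\<ge>\<theta>0. \<forall>\<theta>\<ge>\<theta>1. C * exp (\<theta> - \<theta>0) \<le> m \<theta>)"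
proof (rule disjCI)
  assume "\<not> (\<exists>C>0. \<exists>\<theta>1\<ge>\<theta>0. \<forall>\<theta>\<ge>\<theta>1. C * exp (\<theta> - \<theta>0) \<le> m \<theta>)"
  then have slow: "\<exists>t\<ge>\<theta>1. m t < C * exp (t - \<theta>0)" if "C > 0" "\<theta>1 \<ge> \<theta>0" for C \<theta>1
    using that by (meson not_less)
  have tail: "m \<theta> \<le> 2 * m T * exp (T - \<theta>)" if th: "\<theta> \<ge> T" for \<theta>
  proof (rule field_le_epsilon)
    fix e :: real assume e: "e > 0"
    obtain t where t: "t \<ge> \<theta>" "m t < e / 2 * exp (\<theta>0 - \<theta>) * exp (t - \<theta>0)"
      using slow[of "e / 2 * exp (\<theta>0 - \<theta>)" \<theta>] e th T by auto
    have "exp (\<theta>0 - \<theta>) * exp (t - \<theta>0) * exp (\<theta> - t) = 1"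
      by (simp only: exp_add[symmetric]) simp
    then have "e / 2 * exp (\<theta>0 - \<theta>) * exp (t - \<theta>0) * exp (\<theta> - t) = e / 2"
      by (simp only: mult.assoc mult_1_right)
    moreover have "m t * exp (\<theta> - t) \<le> e / 2 * exp (\<theta>0 - \<theta>) * exp (t - \<theta>0) * exp (\<theta> - t)"
      using t(2) by (intro mult_right_mono) auto
    ultimately show "m \<theta> \<le> 2 * m T * exp (T - \<theta>) + e"
      using two[OF th t(1)] unfolding distrib_left mult.assoc[symmetric] by linarith
  qed
  have top: "m \<theta> \<le> m \<theta>0" if th: "\<theta> \<ge> \<theta>0" for \<theta>
  proof (rule field_le_epsilon)
    fix e :: real assume e: "e > 0"
    have mT: "0 \<le> m T" using nonneg T by simp
    \<comment> \<open>far enough out for the decay estimate to give \<open>m t < e\<close>\<close>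
    define t where "t = max \<theta> (T + 2 * m T / e)"
    have "0 \<le> 2 * m T / e" using mT e by simp
    then have t: "T \<le> t" "\<theta> \<le> t" unfolding t_def by linarith+
    have "2 * m T / e \<le> t - T" by (simp add: t_def)
    also have "\<dots> < exp (t - T)" using exp_ge_add_one_self[of "t - T"] by linarith
    finally have "2 * m T < e * exp (t - T)" using e by (simp add: field_simps)
    then have small: "2 * m T * exp (T - t) < e" by (simp add: exp_diff field_simps)
    show "m \<theta> \<le> m \<theta>0 + e"
      using mp[OF th t(2)] tail[OF t(1)] small nonneg[of \<theta>0] e by (simp add: max_def split: if_splits)
  qed
  have "m \<theta> \<le> 2 * exp (T - \<theta>0) * m \<theta>0 * exp (\<theta>0 - \<theta>)" if th: "\<theta> \<ge> \<theta>0" for \<theta>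
  proof -
    have eq: "2 * exp (T - \<theta>0) * m \<theta>0 * exp (\<theta>0 - \<theta>) = 2 * m \<theta>0 * exp (T - \<theta>)"
      by (simp add: exp_diff)
    show ?thesis
    proof (cases "T \<le> \<theta>")
      case True
      have "2 * m T * exp (T - \<theta>) \<le> 2 * m \<theta>0 * exp (T - \<theta>)"
        using top[OF T] by simp
      then show ?thesis using tail[OF True] unfolding eq by linarith
    next
      case False
      then have "1 \<le> exp (T - \<theta>)" by simp
      then have "m \<theta>0 * 1 \<le> m \<theta>0 * exp (T - \<theta>)" using nonneg[of \<theta>0] by (intro mult_left_mono) auto
      moreover have "0 \<le> m \<theta>0 * exp (T - \<theta>)" using nonneg[of \<theta>0] by simp
      ultimately show ?thesis using top[OF th] unfolding eq by linarith
    qed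
  qed
  then show "\<forall>\<theta>\<ge>\<theta>0. m \<theta> \<le> m \<theta>0 \<and> m \<theta> \<le> 2 * exp (T - \<theta>0) * m \<theta>0 * exp (\<theta>0 - \<theta>)"
    using top by blast
qed

context spiral_problem
begin

text \<open>The function \<open>g\<close> stands for \<open>u\<^sup>+\<close>, with \<open>\<Sigma> = {1}\<close>, or for \<open>|u|\<close>, with \<open>\<Sigma> = {1, -1}\<close>: in both cases a
  nonnegative upper bound for \<open>g\<close> is a common upper bound for the multiples \<open>\<sigma> u\<close>, and the estimates
  for subsolutions apply to each of them.\<close>

lemma cross_section_dichotomy:
  fixes g :: "real ^ 2 \<Rightarrow> real" and \<Sigma> :: "real set"
  assumes T: "narrow_from T" and u: "C2_on U u" "continuous_on Ut u"
    and g: "continuous_on Ut g" "\<And>x. 0 \<le> g x"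
    and g_le: "\<And>x M. 0 \<le> M \<Longrightarrow> g x \<le> M \<longleftrightarrow> (\<forall>\<sigma>\<in>\<Sigma>. \<sigma> * u x \<le> M)"
    and sub: "\<And>\<sigma> x. \<sigma> \<in> \<Sigma> \<Longrightarrow> x \<in> U \<Longrightarrow> \<sigma> * elliptic_op A b u x \<le> 0"
    and sides: "\<And>\<sigma> x. \<sigma> \<in> \<Sigma> \<Longrightarrow> x \<in> \<gamma> \<Longrightarrow> \<sigma> * u x \<le> 0"
  shows "((\<forall>x\<in>Ut. g x \<le> (SUP y\<in>S \<theta>0. g y)) \<and>
      (\<forall>\<theta>\<ge>\<theta>0. (SUP x\<in>S \<theta>. g x)
                  \<le> 2 * exp (T - \<theta>0) * (SUP x\<in>S \<theta>0. g x) * exp (- 1 * (\<theta> - \<theta>0)))) \<or>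
     (\<exists>C>0. \<exists>\<theta>1\<ge>\<theta>0. \<forall>\<theta>\<ge>\<theta>1. (SUP x\<in>S \<theta>. g x) \<ge> C * exp (1 * (\<theta> - \<theta>0)))"
proof -
  have T0: "\<theta>0 \<le> T" using T unfolding narrow_from_def by blast
  define m where "m = (\<lambda>\<theta>. SUP x\<in>S \<theta>. g x)"
  have m_le: "m \<theta> \<le> M \<longleftrightarrow> (\<forall>r. r1 \<theta> \<le> r \<longrightarrow> r \<le> r2 \<theta> \<longrightarrow> g (polar_pt r \<theta>) \<le> M)"
    if "\<theta>0 \<le> \<theta>" for \<theta> M
    using SUP_cross_section_le_iff[OF g(1) that] by (simp add: m_def)
  have g_m: "g (polar_pt r \<theta>) \<le> m \<theta>" if "\<theta>0 \<le> \<theta>" "r1 \<theta> \<le> r" "r \<le> r2 \<theta>" for r \<theta>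
    using m_le[of \<theta> "m \<theta>"] that by simp
  have m0: "0 \<le> m \<theta>" if "\<theta>0 \<le> \<theta>" for \<theta>
    using g_m[of \<theta> "r1 \<theta>"] g(2)[of "polar_pt (r1 \<theta>) \<theta>"] r_less[OF that] that by linarith
  have u_m: "\<sigma> * u (polar_pt r \<theta>) \<le> M"
    if "\<sigma> \<in> \<Sigma>" "m \<theta> \<le> M" "\<theta>0 \<le> \<theta>" "r1 \<theta> \<le> r" "r \<le> r2 \<theta>" for \<sigma> r \<theta> M
  proof -
    have "g (polar_pt r \<theta>) \<le> M" "0 \<le> M" using g_m[of \<theta> r] m0[of \<theta>] that by linarith+
    then show ?thesis using g_le that(1) by simp
  qed
  have mp: "m \<theta> \<le> max (m \<theta>0) (m t)" if th: "\<theta>0 \<le> \<theta>" "\<theta> \<le> t" for \<theta> t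
  proof -
    let ?M = "max (m \<theta>0) (m t)"
    have M: "0 \<le> ?M" using m0[of \<theta>0] by simp
    have "\<sigma> * u (polar_pt r \<theta>) \<le> ?M" if "\<sigma> \<in> \<Sigma>" "r1 \<theta> \<le> r" "r \<le> r2 \<theta>" for \<sigma> r
      by (rule maximum_principle[OF order_refl u _ _ M, where t = t])
         (use sub sides that th u_m in \<open>auto simp: strip_def\<close>)
    then show ?thesis using g_le M th by (simp add: m_le)
  qed
  have two: "m \<theta> \<le> 2 * (m T * exp (T - \<theta>) + m t * exp (\<theta> - t))" if th: "T \<le> \<theta>" "\<theta> \<le> t" for \<theta> t
  proof -
    let ?M = "2 * (m T * exp (T - \<theta>) + m t * exp (\<theta> - t))"
    have m': "0 \<le> m T" "0 \<le> m t" using m0 T0 th by auto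
    then have M: "0 \<le> ?M" by simp
    have "\<sigma> * u (polar_pt r \<theta>) \<le> ?M" if "\<sigma> \<in> \<Sigma>" "r1 \<theta> \<le> r" "r \<le> r2 \<theta>" for \<sigma> r
      by (rule two_sided_decay[OF T order_refl u _ _ m'])
         (use sub sides that th T0 u_m in \<open>auto simp: strip_def\<close>)
    then show ?thesis using g_le M th T0 by (simp add: m_le)
  qed
  have "(\<forall>\<theta>\<ge>\<theta>0. m \<theta> \<le> m \<theta>0 \<and> m \<theta> \<le> 2 * exp (T - \<theta>0) * m \<theta>0 * exp (\<theta>0 - \<theta>)) \<or>
    (\<exists>C>0. \<exists>\<theta>1\<ge>\<theta>0. \<forall>\<theta>\<ge>\<theta>1. C * exp (\<theta> - \<theta>0) \<le> m \<theta>)"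
    by (rule decay_or_growth[OF T0]) (rule m0 mp two; assumption)+
  then show ?thesis
  proof (elim disjE)
    assume dec: "\<forall>\<theta>\<ge>\<theta>0. m \<theta> \<le> m \<theta>0 \<and> m \<theta> \<le> 2 * exp (T - \<theta>0) * m \<theta>0 * exp (\<theta>0 - \<theta>)"
    have "g x \<le> m \<theta>0" if x: "x \<in> Ut" for x
    proof -
      obtain r \<theta> where "x = polar_pt r \<theta>" "\<theta>0 \<le> \<theta>" "r1 \<theta> \<le> r" "r \<le> r2 \<theta>"
        using x by (auto simp: spiral_closed_def)
      then show ?thesis using g_m[of \<theta> r] dec by force
    qed
    with dec show ?thesis unfolding m_def by simp
  next
    assume "\<exists>C>0. \<exists>\<theta>1\<ge>\<theta>0. \<forall>\<theta>\<ge>\<theta>1. C * exp (\<theta> - \<theta>0) \<le> m \<theta>"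
    then show ?thesis unfolding m_def by simp
  qed
qed

end

theorem theorem4p2:
  fixes \<theta>0 rs c0 M1 M2 :: real
    and r1 r2 :: "real \<Rightarrow> real"
    and A :: "real ^ 2 \<Rightarrow> real ^ 2 ^ 2"
    and b :: "real ^ 2 \<Rightarrow> real ^ 2"
    and U Ut \<gamma> :: "(real ^ 2) set"
    and S :: "real \<Rightarrow> (real ^ 2) set"
  assumes r1_cont: "continuous_on {\<theta>0..} r1"
    and r2_cont: "continuous_on {\<theta>0..} r2"
    and r_pos: "\<forall>\<theta>\<ge>\<theta>0. r1 \<theta> > 0 \<and> r2 \<theta> > 0"
    and r_order: "\<forall>\<theta>\<ge>\<theta>0. r2 (\<theta> + 2 * pi) < r1 \<theta> \<and> r1 \<theta> < r2 \<theta>"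
    and rs_pos: "rs > 0"
    and r1_lim: "(r1 \<longlongrightarrow> rs) at_top"
    and r2_lim: "(r2 \<longlongrightarrow> rs) at_top"
    and U_def: "U = spiral_open \<theta>0 r1 r2"
    and Ut_def: "Ut = spiral_closed \<theta>0 r1 r2"
    and \<gamma>_def: "\<gamma> = spiral_sides \<theta>0 r1 r2"
    and S_def: "S = cross_section r1 r2"
    and A_sym: "\<forall>x\<in>U. transpose (A x) = A x"
    and c0_pos: "c0 > 0"
    and M1_pos: "M1 > 0"
    and elliptic: "\<forall>x\<in>U. \<forall>\<xi>. \<xi> \<bullet> (A x *v \<xi>) \<ge> c0 * (norm \<xi>)\<^sup>2"
    and trace_bound: "\<forall>x\<in>U. trace (A x) \<le> M1"
    and M2_nonneg: "M2 \<ge> 0"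
    and drift_bound: "\<forall>x\<in>U. norm (b x) \<le> M2"
  shows "\<exists>Cs \<nu>. Cs > 0 \<and> \<nu> > 0 \<and>
    (\<forall>u :: real ^ 2 \<Rightarrow> real. C2_on U u \<and> continuous_on Ut u \<longrightarrow>
      ((\<forall>x\<in>U. elliptic_op A b u x \<le> 0) \<and> (\<forall>x\<in>\<gamma>. u x \<le> 0) \<longrightarrow>
        ((\<forall>x\<in>Ut. max 0 (u x) \<le> (SUP y\<in>S \<theta>0. max 0 (u y))) \<and>
         (\<forall>\<theta>\<ge>\<theta>0. (SUP x\<in>S \<theta>. max 0 (u x))
                     \<le> Cs * (SUP x\<in>S \<theta>0. max 0 (u x)) * exp (- \<nu> * (\<theta> - \<theta>0))))
        \<or>
        (\<exists>C1>0. \<exists>\<theta>1\<ge>\<theta>0. \<forall>\<theta>\<ge>\<theta>1.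
            (SUP x\<in>S \<theta>. max 0 (u x)) \<ge> C1 * exp (\<nu> * (\<theta> - \<theta>0))))
      \<and>
      ((\<forall>x\<in>U. elliptic_op A b u x = 0) \<and> (\<forall>x\<in>\<gamma>. u x = 0) \<longrightarrow>
        ((\<forall>x\<in>Ut. \<bar>u x\<bar> \<le> (SUP y\<in>S \<theta>0. \<bar>u y\<bar>)) \<and>
         (\<forall>\<theta>\<ge>\<theta>0. (SUP x\<in>S \<theta>. \<bar>u x\<bar>)
                     \<le> Cs * (SUP x\<in>S \<theta>0. \<bar>u x\<bar>) * exp (- \<nu> * (\<theta> - \<theta>0))))
        \<or>
        (\<exists>C>0. \<exists>\<theta>1\<ge>\<theta>0. \<forall>\<theta>\<ge>\<theta>1.
            (SUP x\<in>S \<theta>. \<bar>u x\<bar>) \<ge> C * exp (\<nu> * (\<theta> - \<theta>0)))))"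
proof -
  interpret spiral_problem \<theta>0 rs c0 M1 M2 r1 r2 A b
    using assms by unfold_locales auto
  obtain T where T: "narrow_from T" using exists_narrow_from by blast
  note dich = cross_section_dichotomy[OF T, folded U_def Ut_def \<gamma>_def S_def]
  show ?thesis
  proof (rule exI[of _ "2 * exp (T - \<theta>0)"], rule exI[of _ "1::real"], intro conjI allI impI; (elim conjE)?)
    fix u :: "real ^ 2 \<Rightarrow> real"
    assume u: "C2_on U u" "continuous_on Ut u"
      and h: "\<forall>x\<in>U. elliptic_op A b u x \<le> 0" "\<forall>x\<in>\<gamma>. u x \<le> 0"
    show "((\<forall>x\<in>Ut. max 0 (u x) \<le> (SUP y\<in>S \<theta>0. max 0 (u y))) \<and>
         (\<forall>\<theta>\<ge>\<theta>0. (SUP x\<in>S \<theta>. max 0 (u x))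
                     \<le> 2 * exp (T - \<theta>0) * (SUP x\<in>S \<theta>0. max 0 (u x)) * exp (- 1 * (\<theta> - \<theta>0))))
        \<or>
        (\<exists>C1>0. \<exists>\<theta>1\<ge>\<theta>0. \<forall>\<theta>\<ge>\<theta>1.
            (SUP x\<in>S \<theta>. max 0 (u x)) \<ge> C1 * exp (1 * (\<theta> - \<theta>0)))"
    proof (rule dich[of u _ "{1}"])
      show "continuous_on Ut (\<lambda>x. max 0 (u x))" by (intro continuous_intros u)
    qed (use u h in simp_all)
  next
    fix u :: "real ^ 2 \<Rightarrow> real"
    assume u: "C2_on U u" "continuous_on Ut u"
      and h: "\<forall>x\<in>U. elliptic_op A b u x = 0" "\<forall>x\<in>\<gamma>. u x = 0"
    show "((\<forall>x\<in>Ut. \<bar>u x\<bar> \<le> (SUP y\<in>S \<theta>0. \<bar>u y\<bar>)) \<and>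
         (\<forall>\<theta>\<ge>\<theta>0. (SUP x\<in>S \<theta>. \<bar>u x\<bar>)
                     \<le> 2 * exp (T - \<theta>0) * (SUP x\<in>S \<theta>0. \<bar>u x\<bar>) * exp (- 1 * (\<theta> - \<theta>0))))
        \<or>
        (\<exists>C>0. \<exists>\<theta>1\<ge>\<theta>0. \<forall>\<theta>\<ge>\<theta>1.
            (SUP x\<in>S \<theta>. \<bar>u x\<bar>) \<ge> C * exp (1 * (\<theta> - \<theta>0)))"
    proof (rule dich[of u _ "{1, -1}"])
      show "continuous_on Ut (\<lambda>x. \<bar>u x\<bar>)" by (intro continuous_intros u)
    qed (use u h in \<open>simp_all add: abs_le_iff\<close>)
  qed simp_all
qed

end
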